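(* Let $HG$ be the Heawood graph and let $f:HG\to\mathbb{R}^{2}$ be a plane generic immersion. Let $D_2(HG)$ be the set of all unordered pairs $(d,e)$ of edges of $HG$ whose distance in $HG$ is $2$. Then \[ \sum_{(d,e)\in D_{2}(HG)}|f(d)\cap f(e)|\equiv 1\pmod 2. \]
   Context: The Heawood graph $HG$ has vertices $u_i,v_i$ ($i\in\mathbb{Z}/7\mathbb{Z}$) and the $21$ edges $u_iv_i$, $u_iv_{i-1}$, $v_iu_{i-2}$. A finite graph $G$ is regarded as a topological space in the usual way. A plane generic immersion of $G$ is an immersion $f:G\to\mathbb{R}^2$ (a continuous locally injective, piecewise smooth map) whose multiple points are only finitely many transversal double points between edges, i.e. between interior points of edges (possibly of the same edge). The distance of two connected subgraphs (in particular two edges) of $G$ is the minimum number of edges of a path of $G$ joining them; so distinct edges $d,e$ have distance $2$ iff they are disjoint, no edge is adjacent to both, and there are mutually adjacent edges $x,y$ with $x$ adjacent to $d$ and $y$ adjacent to $e$. $|X|$ denotes the number of elements of a finite set $X$. *)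

theory Defs
  imports "HOL-Analysis.Analysis" "HOL-Library.Extended_Nat" "HOL-Number_Theory.Cong"
begin

text \<open>
  A finite simple graph is given by its set of edges, each edge being the two-element set of its
  end vertices; the vertex set is the whole (finite) vertex type.
\<close>

definition graph_path :: "'v set set \<Rightarrow> 'v list \<Rightarrow> bool" where
  "graph_path E xs \<longleftrightarrow>
     xs \<noteq> [] \<and> distinct xs \<and> (\<forall>i. Suc i < length xs \<longrightarrow> {xs ! i, xs ! Suc i} \<in> E)"

text \<open>
  The arguments \<open>A\<close> and \<open>B\<close> are the vertex sets of the two subgraphs; an edge, as a subgraph, has
  itself as vertex set. The value is \<open>\<infinity>\<close> if no path joins them.
\<close>

definition subgraph_dist :: "'v set set \<Rightarrow> 'v set \<Rightarrow> 'v set \<Rightarrow> enat" where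
  "subgraph_dist E A B =
     Inf {enat (length xs - 1) | xs. graph_path E xs \<and> hd xs \<in> A \<and> last xs \<in> B}"

definition edge_pairs_at_dist :: "enat \<Rightarrow> 'v set set \<Rightarrow> 'v set set set" where
  "edge_pairs_at_dist k E = {{d, e} | d e. d \<in> E \<and> e \<in> E \<and> d \<noteq> e \<and> subgraph_dist E d e = k}"

text \<open>
  The Heawood graph; the indices live in the numeral type \<open>7\<close>, whose arithmetic is that of the
  integers modulo 7.
\<close>

datatype heawood_vertex = HU 7 | HV 7

instance heawood_vertex :: finite
proof
  have "(UNIV :: heawood_vertex set) = range HU \<union> range HV"
    by (auto intro: heawood_vertex.exhaust)
  then show "finite (UNIV :: heawood_vertex set)"
    by (metis finite finite_UnI finite_imageI)
qed

definition heawood :: "heawood_vertex set set" where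
  "heawood = range (\<lambda>i. {HU i, HV i}) \<union> range (\<lambda>i. {HU i, HV (i - 1)}) \<union>
             range (\<lambda>i. {HV i, HU (i - 2)})"

text \<open>
  The topological space of a graph is its geometric realization: vertices are the standard basis
  vectors and edges are the closed segments between them.
\<close>

definition vpoint :: "'v \<Rightarrow> real ^ 'v::finite" where
  "vpoint x = axis x 1"

definition edge_cell :: "'v set \<Rightarrow> (real ^ 'v::finite) set" where
  "edge_cell e = convex hull (vpoint ` e)"

definition edge_interior :: "'v set \<Rightarrow> (real ^ 'v::finite) set" where
  "edge_interior e = edge_cell e - vpoint ` e"

definition graph_space :: "'v set set \<Rightarrow> (real ^ 'v::finite) set" where
  "graph_space E = range vpoint \<union> (\<Union>e\<in>E. edge_cell e)"

text \<open>
  \<open>T\<close> is the one-sided derivative of \<open>f\<close> at \<open>p\<close> in the direction of the end vertex \<open>x\<close> of an edge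
  containing \<open>p\<close>.
\<close>

definition tangent_towards ::
    "(real ^ 'v::finite \<Rightarrow> real ^ 2) \<Rightarrow> real ^ 'v \<Rightarrow> 'v \<Rightarrow> real ^ 2 \<Rightarrow> bool" where
  "tangent_towards f p x T \<longleftrightarrow>
     ((\<lambda>t. f (linepath p (vpoint x) t)) has_vector_derivative T) (at 0 within {0..1})"

definition ray :: "'a::real_vector \<Rightarrow> 'a set" where
  "ray T = {t *\<^sub>R T | t. 0 \<le> t}"

text \<open>
  Transversality of two branches, stated with one-sided tangents because a branch of a piecewise
  smooth map may have a corner at the double point: the two tangent rays of the second branch
  leave into different sides of the two tangent rays of the first. If both branches are
  differentiable along their edges, then \<open>B\<close> and \<open>D\<close> are negative multiples of \<open>A\<close> and \<open>C\<close>, and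
  this says that \<open>A\<close> and \<open>C\<close> are linearly independent. Vanishing tangents are excluded, since the complement of a single ray is
  connected.
\<close>

definition rays_cross :: "real ^ 2 \<Rightarrow> real ^ 2 \<Rightarrow> real ^ 2 \<Rightarrow> real ^ 2 \<Rightarrow> bool" where
  "rays_cross A B C D \<longleftrightarrow>
     C \<notin> ray A \<union> ray B \<and> D \<notin> ray A \<union> ray B \<and>
     \<not> connected_component (- (ray A \<union> ray B)) C D"

definition transversal_at ::
    "(real ^ 'v::finite \<Rightarrow> real ^ 2) \<Rightarrow> 'v set \<Rightarrow> real ^ 'v \<Rightarrow> 'v set \<Rightarrow> real ^ 'v \<Rightarrow> bool" where
  "transversal_at f d p e q \<longleftrightarrow>
     (\<exists>x y z w A B C D. d = {x, y} \<and> e = {z, w} \<and>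
        tangent_towards f p x A \<and> tangent_towards f p y B \<and>
        tangent_towards f q z C \<and> tangent_towards f q w D \<and>
        rays_cross A B C D)"

definition locally_injective_on :: "'a::topological_space set \<Rightarrow> ('a \<Rightarrow> 'b) \<Rightarrow> bool" where
  "locally_injective_on S f \<longleftrightarrow> (\<forall>p\<in>S. \<exists>U. open U \<and> p \<in> U \<and> inj_on f (S \<inter> U))"

text \<open>Here \<open>valid_path\<close> expresses that the parametrized edges are piecewise continuously differentiable.\<close>

definition plane_immersion :: "'v::finite set set \<Rightarrow> (real ^ 'v \<Rightarrow> real ^ 2) \<Rightarrow> bool" where
  "plane_immersion E f \<longleftrightarrow>
     continuous_on (graph_space E) f \<and> locally_injective_on (graph_space E) f \<and>
     (\<forall>x y. {x, y} \<in> E \<longrightarrow> valid_path (f \<circ> linepath (vpoint x) (vpoint y)))"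

text \<open>The case \<open>d = e\<close> is included below: an edge may cross itself.\<close>

definition plane_generic_immersion :: "'v::finite set set \<Rightarrow> (real ^ 'v \<Rightarrow> real ^ 2) \<Rightarrow> bool" where
  "plane_generic_immersion E f \<longleftrightarrow>
     plane_immersion E f \<and>
     finite {f p | p q. p \<in> graph_space E \<and> q \<in> graph_space E \<and> p \<noteq> q \<and> f p = f q} \<and>
     (\<forall>p\<in>graph_space E. \<forall>q\<in>graph_space E. p \<noteq> q \<and> f p = f q \<longrightarrow>
        {r \<in> graph_space E. f r = f p} = {p, q} \<and>
        (\<exists>d\<in>E. \<exists>e\<in>E. p \<in> edge_interior d \<and> q \<in> edge_interior e \<and> transversal_at f d p e q))"

end

theory Submission
  imports Defs
begin

text \<open>
  For disjoint edges \<open>d\<close> and \<open>e\<close>, the number of crossings of \<open>f d\<close> and \<open>f e\<close> has the parity of the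
  winding number about \<open>0\<close> of \<open>f p - f q\<close> along the boundary of \<open>d \<times> e\<close>: every zero of
  \<open>f p - f q\<close> in the rectangle is a transversal double point and contributes \<open>\<plusminus>1\<close>.
  This winding number is a sum of four angle changes, each belonging to a vertex and an edge.
  Choosing a logarithm of \<open>f x - f y\<close> for every pair of vertices, where the logarithms for \<open>(x, y)\<close>
  and \<open>(y, x)\<close> differ by \<open>\<plusminus>\<pi>\<i>\<close> according to a fixed linear order of the vertices, makes each angle
  change an integer \<open>N x e\<close> plus a correction depending only on the order. Hence the crossing number
  of \<open>d\<close> and \<open>e\<close> is congruent modulo 2 to the sum of the \<open>N x e\<close>, \<open>x \<in> d\<close>, and the \<open>N x d\<close>, \<open>x \<in> e\<close>,
  plus 1 if \<open>d\<close> and \<open>e\<close> interlace in the order. In the sum over the pairs at distance 2 each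
  \<open>N x e\<close> occurs an even number of times in the Heawood graph, and the number of interlacing pairs is odd.
\<close>

section \<open>Changes of the logarithm along curves and around rectangles\<close>

text \<open>The branches at a double point may have corners, so no Jacobian sign is at hand there;
  the local index is computed for a pair of broken lines and carried over to \<open>f\<close> by
  comparing the two maps on the boundary of a small square. The map is never deformed to a standard
  drawing. The interlacing term is the crossing number of one fixed drawing, with the vertices on a
  circle in the chosen order and straight edges. The integers \<open>N x e\<close> record how
  \<open>f\<close> departs from it: pushing the edge \<open>e\<close> across the vertex
  \<open>x\<close> changes \<open>N x e\<close> by one, as in the van Kampen obstruction. Hence a
  set of pairs of disjoint edges yields an invariant modulo 2 as soon as, for every edge
  \<open>e\<close> and vertex \<open>x\<close>, evenly many of its pairs {d, e} have
  \<open>x\<close> in \<open>d\<close>; the invariant can then be read off from the circle drawing.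
  For distance 2 this parity comes from the Fano plane, whose incidence graph is the Heawood graph:
  every vertex lies on none or exactly two of the edges at distance 2 from a given edge.\<close>

definition log_change :: "(real \<Rightarrow> complex) \<Rightarrow> real \<Rightarrow> real \<Rightarrow> complex" where
  "log_change g a b = (THE c. \<exists>L. continuous_on {a..b} L \<and> (\<forall>t\<in>{a..b}. exp (L t) = g t) \<and> c = L b - L a)"

text \<open>(L - M) / (2 pi i) is continuous and integer-valued on an interval, hence constant. This
  makes the description in \<open>log_change\<close> unambiguous for continuous curves without
  zeros.\<close>

lemma log_differences_eq:
  fixes L M :: "real \<Rightarrow> complex"
  assumes "a \<le> b" "continuous_on {a..b} L" "continuous_on {a..b} M"
    and eq: "\<And>t. t \<in> {a..b} \<Longrightarrow> exp (L t) = exp (M t)"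
  shows "L b - L a = M b - M a"
proof -
  define D where "D t = (L t - M t) / (2 * pi * \<i>)" for t
  have Z: "D t \<in> \<int>" if "t \<in> {a..b}" for t
  proof -
    have "\<exists>n :: int. L t = M t + (of_int (2 * n) * pi) * \<i>"
      using eq[OF that] unfolding exp_eq .
    then obtain n :: int where "L t = M t + (of_int (2 * n) * pi) * \<i>" ..
    then have "D t = of_int n" by (simp add: D_def)
    then show ?thesis by simp
  qed
  have "D constant_on {a..b}"
  proof (rule continuous_discrete_range_constant)
    show "continuous_on {a..b} D"
      unfolding D_def by (intro continuous_intros assms) simp
    fix x assume x: "x \<in> {a..b}"
    have "1 \<le> norm (D y - D x)" if "y \<in> {a..b}" "D y \<noteq> D x" for y
    proof -
      have "D y - D x \<in> \<int>" using Z x that by (intro Ints_diff) auto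
      then obtain n where "D y - D x = of_int n" by (auto elim: Ints_cases)
      moreover from this have "n \<noteq> 0" using that by auto
      ultimately show ?thesis by (simp add: norm_of_int)
    qed
    then show "\<exists>e>0. \<forall>y. y \<in> {a..b} \<and> D y \<noteq> D x \<longrightarrow> e \<le> norm (D y - D x)"
      by (intro exI[of _ 1]) auto
  qed auto
  then have "D b = D a"
    using assms(1) by (auto simp: constant_on_def)
  then have "L b - M b = L a - M a" by (simp add: D_def)
  then show ?thesis by (simp add: algebra_simps)
qed

lemma log_change_eqI:
  assumes "a \<le> b" "continuous_on {a..b} L" "\<And>t. t \<in> {a..b} \<Longrightarrow> exp (L t) = g t"
  shows "log_change g a b = L b - L a"
  unfolding log_change_def
proof (rule the_equality)
  show "\<exists>M. continuous_on {a..b} M \<and> (\<forall>t\<in>{a..b}. exp (M t) = g t) \<and> L b - L a = M b - M a"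
    using assms by blast
  show "c = L b - L a"
    if "\<exists>M. continuous_on {a..b} M \<and> (\<forall>t\<in>{a..b}. exp (M t) = g t) \<and> c = M b - M a" for c
    using that log_differences_eq[OF assms(1) _ assms(2)] assms(3) by force
qed

lemma continuous_logarithm_on_interval:
  fixes g :: "real \<Rightarrow> complex"
  assumes "continuous_on {a..b} g" "\<And>t. t \<in> {a..b} \<Longrightarrow> g t \<noteq> 0"
  obtains L where "continuous_on {a..b} L" "\<And>t. t \<in> {a..b} \<Longrightarrow> exp (L t) = g t"
  using continuous_logarithm_on_contractible[OF assms(1) convex_imp_contractible] assms(2)
  by (metis convex_real_interval(5))

lemma log_change_combine:
  assumes "continuous_on {a..b} g" "\<And>t. t \<in> {a..b} \<Longrightarrow> g t \<noteq> 0" "a \<le> m" "m \<le> b"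
  shows "log_change g a b = log_change g a m + log_change g m b"
proof -
  obtain L where L: "continuous_on {a..b} L" "\<And>t. t \<in> {a..b} \<Longrightarrow> exp (L t) = g t"
    using continuous_logarithm_on_interval[OF assms(1,2)] by blast
  have "log_change g a b = L b - L a" "log_change g a m = L m - L a" "log_change g m b = L b - L m"
    using assms L by (auto intro!: log_change_eqI intro: continuous_on_subset)
  then show ?thesis by simp
qed

lemma exp_log_change:
  assumes "continuous_on {a..b} g" "\<And>t. t \<in> {a..b} \<Longrightarrow> g t \<noteq> 0" "a \<le> b"
  shows "exp (log_change g a b) = g b / g a"
proof -
  obtain L where L: "continuous_on {a..b} L" "\<And>t. t \<in> {a..b} \<Longrightarrow> exp (L t) = g t"
    using continuous_logarithm_on_interval[OF assms(1,2)] by blast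
  then show ?thesis
    using log_change_eqI[OF assms(3) L] assms(3) by (simp add: exp_diff)
qed

text \<open>Adding pi i to a logarithm of \<open>g\<close> gives one of \<open>- g\<close>. It lets
  a side of the rectangle on which the vertex belongs to the second edge use the same angle as a
  side on which it belongs to the first.\<close>

lemma log_change_uminus:
  assumes "continuous_on {a..b} g" "\<And>t. t \<in> {a..b} \<Longrightarrow> g t \<noteq> 0" "a \<le> b"
  shows "log_change (\<lambda>t. - g t) a b = log_change g a b"
proof -
  obtain L where L: "continuous_on {a..b} L" "\<And>t. t \<in> {a..b} \<Longrightarrow> exp (L t) = g t"
    using continuous_logarithm_on_interval[OF assms(1,2)] by blast
  have "log_change (\<lambda>t. - g t) a b = (L b + pi * \<i>) - (L a + pi * \<i>)"
    by (rule log_change_eqI[where L = "\<lambda>t. L t + pi * \<i>"])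
       (use L assms in \<open>auto intro!: continuous_intros simp: exp_add\<close>)
  then show ?thesis
    using log_change_eqI[OF assms(3) L] by simp
qed

text \<open>The quotient \<open>g t / h t\<close> stays in the disc of radius 1 around 1, where the
  principal logarithm is continuous, so adding its \<open>Ln\<close> to a logarithm of
  \<open>h\<close> gives one of \<open>g\<close>. The end terms are kept because they cancel only
  when four sides are put together.\<close>

lemma log_change_perturb:
  assumes g: "continuous_on {a..b} g" and h: "continuous_on {a..b} h" and "a \<le> b"
    and near: "\<And>t. t \<in> {a..b} \<Longrightarrow> norm (g t - h t) < norm (h t)"
  shows "log_change g a b = log_change h a b + Ln (g b / h b) - Ln (g a / h a)"
proof -
  have h0: "h t \<noteq> 0" if "t \<in> {a..b}" for t using near[OF that] by auto
  have q: "g t / h t \<notin> \<real>\<^sub>\<le>\<^sub>0 \<and> g t / h t \<noteq> 0" if "t \<in> {a..b}" for t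
  proof -
    have "g t / h t - 1 = (g t - h t) / h t" using h0[OF that] by (simp add: field_simps)
    then have "norm (g t / h t - 1) < 1"
      using near[OF that] h0[OF that] by (simp add: norm_divide)
    then have "\<bar>Re (g t / h t - 1)\<bar> < 1" using abs_Re_le_cmod order_le_less_trans by blast
    then have "Re (g t / h t) > 0" by simp
    then show ?thesis by (auto simp: complex_nonpos_Reals_iff)
  qed
  obtain L where L: "continuous_on {a..b} L" "\<And>t. t \<in> {a..b} \<Longrightarrow> exp (L t) = h t"
    using continuous_logarithm_on_interval[OF h h0] by blast
  have "log_change g a b = (L b + Ln (g b / h b)) - (L a + Ln (g a / h a))"
  proof (rule log_change_eqI[where L = "\<lambda>t. L t + Ln (g t / h t)"])
    show "continuous_on {a..b} (\<lambda>t. L t + Ln (g t / h t))"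
      using q h0 by (intro continuous_intros L g h) auto
    show "exp (L t + Ln (g t / h t)) = g t" if "t \<in> {a..b}" for t
      using q[OF that] h0[OF that] L(2)[OF that] by (simp add: exp_add)
  qed fact
  then show ?thesis
    using log_change_eqI[OF assms(3) L] by simp
qed

text \<open>Counterclockwise: bottom and right, then top and left reversed. If \<open>F\<close> has
  no zero on the boundary, this is 2 pi i times its winding number about 0.\<close>

definition rect_log_change ::
    "(real \<Rightarrow> real \<Rightarrow> complex) \<Rightarrow> real \<Rightarrow> real \<Rightarrow> real \<Rightarrow> real \<Rightarrow> complex" where
  "rect_log_change F a b c d =
     log_change (\<lambda>s. F s c) a b + log_change (F b) c d - log_change (\<lambda>s. F s d) a b - log_change (F a) c d"

lemma continuous_on_slices:
  assumes "continuous_on ({a..b} \<times> {c..d}) (\<lambda>(s, t). F s t)"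
  shows "s \<in> {a..b} \<Longrightarrow> continuous_on {c..d} (F s)"
    and "t \<in> {c..d} \<Longrightarrow> continuous_on {a..b} (\<lambda>s. F s t)"
proof -
  show "continuous_on {c..d} (F s)" if "s \<in> {a..b}"
    using continuous_on_compose2[OF assms, of "{c..d}" "\<lambda>t. (s, t)"] that
    continuous_on_Pair[OF continuous_on_const continuous_on_id] by fastforce
  show "continuous_on {a..b} (\<lambda>s. F s t)" if "t \<in> {c..d}"
    using continuous_on_compose2[OF assms, of "{a..b}" "\<lambda>s. (s, t)"] that
    continuous_on_Pair[OF continuous_on_id continuous_on_const] by fastforce
qed

text \<open>The rectangle is contractible, so one continuous logarithm exists on all of it; each
  side contributes a difference of corner values and the sum telescopes.\<close>

lemma rect_log_change_0:
  fixes F :: "real \<Rightarrow> real \<Rightarrow> complex"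
  assumes F: "continuous_on ({a..b} \<times> {c..d}) (\<lambda>(s, t). F s t)" and "a \<le> b" "c \<le> d"
    and nz: "\<And>s t. s \<in> {a..b} \<Longrightarrow> t \<in> {c..d} \<Longrightarrow> F s t \<noteq> 0"
  shows "rect_log_change F a b c d = 0"
proof -
  have "contractible ({a..b} \<times> {c..d})" by (intro convex_imp_contractible convex_Times) auto
  then obtain L where L: "continuous_on ({a..b} \<times> {c..d}) L"
      "\<And>z. z \<in> {a..b} \<times> {c..d} \<Longrightarrow> (\<lambda>(s, t). F s t) z = exp (L z)"
    using continuous_logarithm_on_contractible[OF F] nz by (metis (no_types, lifting) case_prod_conv mem_Sigma_iff prod.collapse)
  have L': "continuous_on ({a..b} \<times> {c..d}) (\<lambda>(s, t). L (s, t))" using L(1) by simp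
  note * = continuous_on_slices[OF L']
  have "log_change (\<lambda>s. F s t) a b = L (b, t) - L (a, t)" if "t \<in> {c..d}" for t
    by (rule log_change_eqI[where L="\<lambda>s. L (s, t)"]) (use that assms L(2) *(2) in force)+
  moreover have "log_change (F s) c d = L (s, d) - L (s, c)" if "s \<in> {a..b}" for s
    by (rule log_change_eqI[where L="\<lambda>t. L (s, t)"]) (use that assms L(2) *(1) in force)+
  ultimately show ?thesis using assms by (simp add: rect_log_change_def)
qed

text \<open>The cut at \<open>m\<close> is the right side of one part and the left side of the other
  and cancels as a term; zeros have to be excluded just on the two sides that are divided.\<close>

lemma rect_log_change_split_first:
  fixes F :: "real \<Rightarrow> real \<Rightarrow> complex"
  assumes F: "continuous_on ({a..b} \<times> {c..d}) (\<lambda>(s, t). F s t)" and "a \<le> m" "m \<le> b" "c \<le> d"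
    and nz: "\<And>s t. s \<in> {a..b} \<Longrightarrow> t \<in> {c, d} \<Longrightarrow> F s t \<noteq> 0"
  shows "rect_log_change F a b c d = rect_log_change F a m c d + rect_log_change F m b c d"
proof -
  have "log_change (\<lambda>s. F s t) a b = log_change (\<lambda>s. F s t) a m + log_change (\<lambda>s. F s t) m b"
    if "t \<in> {c, d}" for t
    using that assms by (intro log_change_combine continuous_on_slices(2)[OF F]) auto
  then show ?thesis by (simp add: rect_log_change_def)
qed

lemma rect_log_change_split_second:
  fixes F :: "real \<Rightarrow> real \<Rightarrow> complex"
  assumes F: "continuous_on ({a..b} \<times> {c..d}) (\<lambda>(s, t). F s t)" and "c \<le> m" "m \<le> d" "a \<le> b"
    and nz: "\<And>s t. s \<in> {a, b} \<Longrightarrow> t \<in> {c..d} \<Longrightarrow> F s t \<noteq> 0"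
  shows "rect_log_change F a b c d = rect_log_change F a b c m + rect_log_change F a b m d"
proof -
  have "log_change (F s) c d = log_change (F s) c m + log_change (F s) m d"
    if "s \<in> {a, b}" for s
    using that assms by (intro log_change_combine continuous_on_slices(1)[OF F]) auto
  then show ?thesis by (simp add: rect_log_change_def)
qed

text \<open>Rouche's comparison: every corner contributes the logarithm of its quotient from two
  sides with opposite signs, so the end terms of \<open>log_change_perturb\<close> cancel.\<close>

lemma rect_log_change_perturb:
  fixes F G :: "real \<Rightarrow> real \<Rightarrow> complex"
  assumes F: "continuous_on ({a..b} \<times> {c..d}) (\<lambda>(s, t). F s t)"
    and G: "continuous_on ({a..b} \<times> {c..d}) (\<lambda>(s, t). G s t)" and "a \<le> b" "c \<le> d"
    and near: "\<And>s t. s \<in> {a..b} \<Longrightarrow> t \<in> {c..d} \<Longrightarrow> s \<in> {a, b} \<or> t \<in> {c, d} \<Longrightarrow>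
      norm (F s t - G s t) < norm (G s t)"
  shows "rect_log_change F a b c d = rect_log_change G a b c d"
proof -
  have 1: "log_change (\<lambda>s. F s t) a b =
      log_change (\<lambda>s. G s t) a b + Ln (F b t / G b t) - Ln (F a t / G a t)" if "t \<in> {c, d}" for t
    using that assms by (intro log_change_perturb near continuous_on_slices(2)[OF F] continuous_on_slices(2)[OF G]) auto
  have 2: "log_change (F s) c d =
      log_change (G s) c d + Ln (F s d / G s d) - Ln (F s c / G s c)" if "s \<in> {a, b}" for s
    using that assms by (intro log_change_perturb near continuous_on_slices(1)[OF F] continuous_on_slices(1)[OF G]) auto
  show ?thesis by (simp add: rect_log_change_def 1 2)
qed

text \<open>All sufficiently small squares are required to have odd winding number, so that the
  square can be shrunk as far as the other zeros demand. Recording only the parity avoids any choice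
  of orientation.\<close>

definition odd_index_at :: "(real \<Rightarrow> real \<Rightarrow> complex) \<Rightarrow> real \<Rightarrow> real \<Rightarrow> bool" where
  "odd_index_at F p q \<longleftrightarrow> (\<exists>\<delta>0>0. \<forall>\<delta>. 0 < \<delta> \<and> \<delta> \<le> \<delta>0 \<longrightarrow>
     (\<exists>k::int. odd k \<and> rect_log_change F (p - \<delta>) (p + \<delta>) (q - \<delta>) (q + \<delta>) = of_int k * (2 * pi * \<i>)))"

lemma rect_log_change_strip:
  fixes F :: "real \<Rightarrow> real \<Rightarrow> complex"
  assumes F: "continuous_on ({a..b} \<times> {c..d}) (\<lambda>(s, t). F s t)"
    and "0 < \<delta>" "c \<le> q - \<delta>" "q + \<delta> \<le> d" "a = p - \<delta>" "b = p + \<delta>"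
    and nz: "\<And>s t. s \<in> {a..b} \<Longrightarrow> t \<in> {c..d} \<Longrightarrow> (s, t) \<noteq> (p, q) \<Longrightarrow> F s t \<noteq> 0"
  shows "rect_log_change F a b c d = rect_log_change F (p - \<delta>) (p + \<delta>) (q - \<delta>) (q + \<delta>)"
proof -
  have sub: "continuous_on ({a..b} \<times> {c'..d'}) (\<lambda>(s, t). F s t)" if "c \<le> c'" "d' \<le> d" for c' d'
    using F by (rule continuous_on_subset) (use that in auto)
  have "rect_log_change F a b c d = rect_log_change F a b c (q - \<delta>) + rect_log_change F a b (q - \<delta>) d"
    by (rule rect_log_change_split_second) (use assms in auto)
  also have "rect_log_change F a b (q - \<delta>) d =
      rect_log_change F a b (q - \<delta>) (q + \<delta>) + rect_log_change F a b (q + \<delta>) d"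
    by (rule rect_log_change_split_second) (use assms sub in auto)
  also have "rect_log_change F a b (q + \<delta>) d = 0"
    by (rule rect_log_change_0) (use assms sub in auto)
  also have "rect_log_change F a b c (q - \<delta>) = 0"
    by (rule rect_log_change_0) (use assms sub in auto)
  finally show ?thesis using assms by simp
qed

text \<open>Induction on the number of zeros: the zero with the largest first coordinate is enclosed
  in a thin vertical strip; the part to its right is free of zeros and the part to its left has one
  zero less. Injectivity of \<open>fst\<close> keeps the other zeros out of the strip.\<close>

lemma rect_log_change_parity:
  fixes F :: "real \<Rightarrow> real \<Rightarrow> complex"
  assumes "continuous_on ({a..b} \<times> {c..d}) (\<lambda>(s, t). F s t)" "a \<le> b" "c \<le> d"
    and "Z = {(s, t). s \<in> {a..b} \<and> t \<in> {c..d} \<and> F s t = 0}" "finite Z" "inj_on fst Z"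
    and "Z \<subseteq> {a<..<b} \<times> {c<..<d}"
    and "\<And>p q. (p, q) \<in> Z \<Longrightarrow> odd_index_at F p q"
  shows "\<exists>k::int. rect_log_change F a b c d = of_int k * (2 * pi * \<i>) \<and> (odd k \<longleftrightarrow> odd (card Z))"
  using assms
proof (induction "card Z" arbitrary: b Z)
  case 0
  then have "rect_log_change F a b c d = 0"
    by (intro rect_log_change_0) auto
  moreover have "card Z = 0" using 0 by simp
  ultimately show ?case by (intro exI[of _ 0]) (simp only: of_int_0 mult_zero_left even_zero)
next
  case (Suc n)
  note F = Suc.prems(1) and Z = Suc.prems(4) and fin = Suc.prems(5) and Zsub = Suc.prems(7)
  have nz: "F s t \<noteq> 0" if "(s, t) \<notin> Z" "s \<in> {a..b}" "t \<in> {c..d}" for s t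
    using that unfolding Z by blast
  define p where "p = Max (fst ` Z)"
  have "Z \<noteq> {}" using Suc.hyps(2) by auto
  then have "p \<in> fst ` Z" unfolding p_def using fin by (intro Max_in) auto
  then obtain q where pq: "(p, q) \<in> Z" by force
  have pmax: "s < p" if "(s, t) \<in> Z - {(p, q)}" for s t
  proof -
    have "s \<le> p" unfolding p_def using that fin by (force intro: Max_ge)
    moreover have "s \<noteq> p" using that pq inj_onD[OF Suc.prems(6), of "(s, t)" "(p, q)"] by auto
    ultimately show ?thesis by simp
  qed
  define Z' where "Z' = Z - {(p, q)}"
  have in0: "a < p" "p < b" "c < q" "q < d" using Zsub pq by auto
  obtain \<delta>1 where \<delta>1: "\<delta>1 > 0" and idx: "\<And>\<delta>. 0 < \<delta> \<Longrightarrow> \<delta> \<le> \<delta>1 \<Longrightarrow>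
     \<exists>k::int. odd k \<and> rect_log_change F (p - \<delta>) (p + \<delta>) (q - \<delta>) (q + \<delta>) = of_int k * (2 * pi * \<i>)"
    using Suc.prems(8)[OF pq] unfolding odd_index_at_def by blast
  \<comment> \<open>Half of the least of these gaps makes the strip stay inside the rectangle and
    miss all other zeros, and makes the square around (p, q) small enough for the odd index.\<close>
  define B where "B = insert \<delta>1 ({p - a, b - p, q - c, d - q} \<union> (\<lambda>z. p - fst z) ` Z')"
  define \<delta> where "\<delta> = Min B / 2"
  have finB: "finite B" unfolding B_def Z'_def using fin by auto
  have "Min B \<in> B" by (rule Min_in[OF finB]) (auto simp: B_def)
  moreover have "x > 0" if "x \<in> B" for x
  proof -
    have "p - fst z > 0" if "z \<in> Z'" for z using pmax[of "fst z" "snd z"] that by (simp add: Z'_def)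
    with that in0 \<delta>1 show ?thesis unfolding B_def by auto
  qed
  ultimately have \<delta>pos: "\<delta> > 0" unfolding \<delta>_def by (simp add: half_gt_zero)
  have \<delta>less: "\<delta> < x" if "x \<in> B" for x
    using Min_le[OF finB that] \<delta>pos unfolding \<delta>_def by linarith
  have bounds: "\<delta> \<le> \<delta>1" "a < p - \<delta>" "p + \<delta> < b" "c < q - \<delta>" "q + \<delta> < d"
    using \<delta>less[of \<delta>1] \<delta>less[of "p - a"] \<delta>less[of "b - p"] \<delta>less[of "q - c"] \<delta>less[of "d - q"]
    by (auto simp: B_def)
  have other: "s < p - \<delta>" if "(s, t) \<in> Z" "(s, t) \<noteq> (p, q)" for s t
    using \<delta>less[of "p - s"] that by (force simp: B_def Z'_def)
  have sub: "continuous_on ({a'..b'} \<times> {c..d}) (\<lambda>(s, t). F s t)" if "a \<le> a'" "b' \<le> b" for a' b'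
    using F by (rule continuous_on_subset) (use that in auto)
  have bd: "(s, c) \<notin> Z" "(s, d) \<notin> Z" for s using Zsub by auto
  have nz2: "F s t \<noteq> 0" if "s \<in> {p - \<delta>..b}" "t \<in> {c..d}" "(s, t) \<noteq> (p, q)" for s t
    by (rule nz) (use that bounds \<delta>pos other[of s t] in auto)
  have nzb: "F s t \<noteq> 0" if "s \<in> {a..b}" "t \<in> {c, d}" for s t
    by (rule nz) (use that bd Suc.prems(3) in auto)
  have "rect_log_change F a b c d = rect_log_change F a (p - \<delta>) c d + rect_log_change F (p - \<delta>) b c d"
    by (rule rect_log_change_split_first[OF F]) (use bounds \<delta>pos Suc.prems(3) nzb in auto)
  also have "rect_log_change F (p - \<delta>) b c d =
      rect_log_change F (p - \<delta>) (p + \<delta>) c d + rect_log_change F (p + \<delta>) b c d"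
    by (rule rect_log_change_split_first[OF sub])
       (use bounds \<delta>pos Suc.prems(3) nzb in auto)
  also have "rect_log_change F (p + \<delta>) b c d = 0"
    by (rule rect_log_change_0[OF sub])
       (use bounds \<delta>pos Suc.prems(3) nz2 in auto)
  also have "rect_log_change F (p - \<delta>) (p + \<delta>) c d =
      rect_log_change F (p - \<delta>) (p + \<delta>) (q - \<delta>) (q + \<delta>)"
    by (rule rect_log_change_strip[OF sub])
       (use bounds \<delta>pos in0 nz2 in auto)
  finally have W: "rect_log_change F a b c d =
      rect_log_change F a (p - \<delta>) c d + rect_log_change F (p - \<delta>) (p + \<delta>) (q - \<delta>) (q + \<delta>)" by simp
  have Z'eq: "Z' = {(s, t). s \<in> {a..p - \<delta>} \<and> t \<in> {c..d} \<and> F s t = 0}" (is "_ = ?R")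
  proof (intro equalityI subsetI)
    fix z assume "z \<in> Z'" then show "z \<in> ?R"
      using other[of "fst z" "snd z"] unfolding Z'_def Z by auto
  next
    fix z assume "z \<in> ?R" then show "z \<in> Z'"
      using bounds \<delta>pos unfolding Z'_def Z by auto
  qed
  have cardZ: "card Z = Suc (card Z')"
    unfolding Z'_def using pq fin by (metis card.remove)
  then have n: "n = card Z'" using Suc.hyps(2) by simp
  have Z'sub: "Z' \<subseteq> {a<..<p - \<delta>} \<times> {c<..<d}"
  proof
    fix z assume "z \<in> Z'"
    then show "z \<in> {a<..<p - \<delta>} \<times> {c<..<d}"
      using Zsub other[of "fst z" "snd z"] by (cases z) (auto simp: Z'_def)
  qed
  have "\<exists>k::int. rect_log_change F a (p - \<delta>) c d = of_int k * (2 * pi * \<i>) \<and> (odd k \<longleftrightarrow> odd (card Z'))"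
  proof (rule Suc.hyps(1)[OF n sub _ _ Z'eq])
    show "inj_on fst Z'" using Suc.prems(6) unfolding Z'_def by (rule inj_on_subset) blast
    show "odd_index_at F s t" if "(s, t) \<in> Z'" for s t
      using that Suc.prems(8) unfolding Z'_def by blast
    show "finite Z'" using fin unfolding Z'_def by simp
  qed (use Z'sub bounds \<delta>pos Suc.prems(3) in auto)
  then obtain k where k: "rect_log_change F a (p - \<delta>) c d = of_int k * (2 * pi * \<i>)" "odd k \<longleftrightarrow> odd (card Z')"
    by blast
  obtain l where "odd l" "rect_log_change F (p - \<delta>) (p + \<delta>) (q - \<delta>) (q + \<delta>) = of_int l * (2 * pi * \<i>)"
    using idx[OF \<delta>pos bounds(1)] by blast
  with k show ?case
    unfolding W cardZ by (intro exI[of _ "k + l"]) (simp add: distrib_right)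
qed

text \<open>Factoring out \<open>X\<close> leaves \<open>u t - v t * (Y / X)\<close>, which is never
  a nonpositive real because \<open>Y\<close> is no nonnegative multiple of \<open>X\<close> and the
  coefficients are nonnegative and not both 0. So the principal logarithm is continuous along the
  whole curve.\<close>

lemma log_change_two_rays:
  fixes X Y :: complex
  assumes "a \<le> b" "continuous_on {a..b} u" "continuous_on {a..b} v" "X \<noteq> 0" "Y \<notin> ray X"
    and pos: "\<And>t. t \<in> {a..b} \<Longrightarrow> 0 \<le> u t \<and> 0 \<le> v t \<and> (u t \<noteq> 0 \<or> v t \<noteq> 0)"
    and g: "\<And>t. t \<in> {a..b} \<Longrightarrow> g t = u t *\<^sub>R X - v t *\<^sub>R Y"
  shows "log_change g a b = Ln (u b - v b * (Y / X)) - Ln (u a - v a * (Y / X))"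
proof -
  have nr: "u t - v t * (Y / X) \<notin> \<real>\<^sub>\<le>\<^sub>0" if t: "t \<in> {a..b}" for t
  proof
    assume "u t - v t * (Y / X) \<in> \<real>\<^sub>\<le>\<^sub>0"
    then obtain r where r: "r \<le> 0" "u t - v t * (Y / X) = of_real r"
      by (auto elim: nonpos_Reals_cases)
    show False
    proof (cases "v t = 0")
      case True
      with r have "of_real (u t) = (of_real r :: complex)" by simp
      then have "u t = r" using of_real_eq_iff by blast
      with pos[OF t] True r show False by auto
    next
      case False
      have "Y = ((u t - r) / v t) *\<^sub>R X"
        using r(2) False \<open>X \<noteq> 0\<close> by (simp add: scaleR_conv_of_real field_simps)
      moreover have "(u t - r) / v t \<ge> 0" using pos[OF t] r by simp
      ultimately show False using \<open>Y \<notin> ray X\<close> by (auto simp: ray_def)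
    qed
  qed
  have "log_change g a b = (Ln X + Ln (u b - v b * (Y / X))) - (Ln X + Ln (u a - v a * (Y / X)))"
  proof (rule log_change_eqI[where L = "\<lambda>t. Ln X + Ln (u t - v t * (Y / X))"])
    show "continuous_on {a..b} (\<lambda>t. Ln X + Ln (u t - v t * (Y / X)))"
      using nr \<open>X \<noteq> 0\<close> by (intro continuous_intros assms) auto
    show "exp (Ln X + Ln (u t - v t * (Y / X))) = g t" if "t \<in> {a..b}" for t
    proof -
      have "X * (u t - v t * (Y / X)) = g t"
        using \<open>X \<noteq> 0\<close> g[OF that] by (simp add: scaleR_conv_of_real right_diff_distrib mult.commute)
      moreover have "u t - v t * (Y / X) \<noteq> 0" using nr[OF that] by auto
      ultimately show ?thesis using \<open>X \<noteq> 0\<close> by (simp only: exp_add exp_Ln not_False_eq_True)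
    qed
  qed fact
  then show ?thesis by simp
qed

section \<open>The index of a transversal crossing\<close>

lemma ray_scaleR: "0 \<le> r \<Longrightarrow> r *\<^sub>R X \<in> ray X"
  by (auto simp: ray_def)

lemma ray_zero: "0 \<in> ray X"
  by (force simp: ray_def)

lemma minus_divide_notin_nonpos_Reals:
  fixes X z :: complex
  assumes "X \<noteq> 0" "z \<notin> ray X"
  shows "- (z / X) \<notin> \<real>\<^sub>\<le>\<^sub>0"
proof
  assume "- (z / X) \<in> \<real>\<^sub>\<le>\<^sub>0"
  then obtain r where "r \<le> 0" "- (z / X) = of_real r" using nonpos_Reals_cases by blast
  have "z = - (- (z / X)) * X" using assms by simp
  also have "\<dots> = (- r) *\<^sub>R X" unfolding \<open>- (z / X) = of_real r\<close> by (simp add: scaleR_conv_of_real)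
  finally have "z = (- r) *\<^sub>R X" .
  then show False using assms ray_scaleR[of "- r" X] \<open>r \<le> 0\<close> by simp
qed

lemma abs_Im_Ln_less_pi:
  assumes "z \<notin> \<real>\<^sub>\<le>\<^sub>0"
  shows "\<bar>Im (Ln z)\<bar> < pi"
proof -
  have "z \<noteq> 0" using assms by auto
  then show ?thesis using Im_Ln_less_pi[OF assms] mpi_less_Im_Ln[of z] by linarith
qed

text \<open>A nonzero point of the ray would make \<open>exp \<zeta>\<close> a negative real, whose
  principal logarithm has imaginary part pi; in the open strip that logarithm is \<zeta>
  itself.\<close>

lemma exp_image_avoids_ray:
  fixes X \<zeta> :: complex
  assumes "\<bar>Im \<zeta>\<bar> < pi"
  shows "- (X * exp \<zeta>) \<notin> ray X - {0}"
proof
  assume "- (X * exp \<zeta>) \<in> ray X - {0}"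
  then obtain r where r: "r \<ge> 0" "- (X * exp \<zeta>) = of_real r * X" "X \<noteq> 0"
    by (auto simp: ray_def scaleR_conv_of_real)
  have "X * (exp \<zeta> + of_real r) = X * exp \<zeta> + of_real r * X" by (simp add: algebra_simps)
  also have "\<dots> = 0" unfolding r(2)[symmetric] by simp
  finally have "X * (exp \<zeta> + of_real r) = 0" .
  then have e: "exp \<zeta> = - of_real r" using r(3) by (simp add: eq_neg_iff_add_eq_0)
  have "\<zeta> = Ln (exp \<zeta>)" using assms by (intro Ln_exp[symmetric]) auto
  moreover have "Im (Ln (- of_real r)) = pi" if "r > 0"
    using that by (subst Im_Ln_eq_pi) auto
  moreover have "r \<noteq> 0" using e by auto
  ultimately show False using e r(1) assms by auto
qed

text \<open>
  The set of all \<open>z\<close> with a given value of \<open>Ln (- (z / A)) - Ln (- (z / B))\<close> is connected, being the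
  image of a convex strip under \<open>\<zeta> \<mapsto> - A * exp \<zeta>\<close>.
\<close>

lemma connected_component_via_strip:
  fixes A B C D :: complex
  assumes "A \<noteq> 0" "B \<noteq> 0" and C: "C \<notin> ray A \<union> ray B" and D: "D \<notin> ray A \<union> ray B"
    and eq: "Ln (- (C / A)) - Ln (- (C / B)) = Ln (- (D / A)) - Ln (- (D / B))"
  shows "connected_component (- (ray A \<union> ray B)) C D"
proof -
  define \<kappa> where "\<kappa> = Ln (- (C / A)) - Ln (- (C / B))"
  \<comment> \<open>Since A * exp \<zeta> = B * exp (\<zeta> - \<kappa>), the first bound keeps the
    image off \<open>ray A\<close> and the second keeps it off \<open>ray B\<close>.\<close>
  define S where "S = {\<zeta>. \<bar>Im \<zeta>\<bar> < pi \<and> \<bar>Im (\<zeta> - \<kappa>)\<bar> < pi}"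
  have nz: "z \<noteq> 0" if "z \<notin> ray A \<union> ray B" for z using that ray_zero by auto
  have Im: "\<bar>Im (Ln (- (z / X)))\<bar> < pi" if "X \<noteq> 0" "z \<notin> ray X" for X z
    by (intro abs_Im_Ln_less_pi minus_divide_notin_nonpos_Reals that)
  have "S = {\<zeta>. - pi < Im \<zeta>} \<inter> {\<zeta>. Im \<zeta> < pi} \<inter> {\<zeta>. Im \<kappa> - pi < Im \<zeta>} \<inter> {\<zeta>. Im \<zeta> < Im \<kappa> + pi}"
    by (auto simp: S_def)
  then have "convex S"
    by (auto intro!: convex_Int convex_halfspace_Im_gt convex_halfspace_Im_lt)
  then have conn: "connected ((\<lambda>\<zeta>. - (A * exp \<zeta>)) ` S)"
    by (intro connected_continuous_image convex_connected continuous_intros)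
  have AB: "A = B * exp (- \<kappa>)"
    using assms nz[OF C] by (simp add: \<kappa>_def exp_diff exp_minus field_simps)
  have "- (A * exp \<zeta>) \<notin> ray A \<union> ray B" if "\<zeta> \<in> S" for \<zeta>
  proof -
    have "- (A * exp \<zeta>) \<notin> ray A"
      using exp_image_avoids_ray[of \<zeta> A] that \<open>A \<noteq> 0\<close> by (auto simp: S_def)
    moreover have "A * exp \<zeta> = B * exp (\<zeta> - \<kappa>)"
      by (subst AB) (simp add: exp_diff exp_minus field_simps)
    then have "- (A * exp \<zeta>) \<notin> ray B"
      using exp_image_avoids_ray[of "\<zeta> - \<kappa>" B] that \<open>B \<noteq> 0\<close> by (auto simp: S_def)
    ultimately show ?thesis by blast
  qed
  then have sub: "(\<lambda>\<zeta>. - (A * exp \<zeta>)) ` S \<subseteq> - (ray A \<union> ray B)" by auto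
  have mem: "z \<in> (\<lambda>\<zeta>. - (A * exp \<zeta>)) ` S"
    if "z \<notin> ray A \<union> ray B" "Ln (- (z / A)) - Ln (- (z / B)) = \<kappa>" for z
  proof
    have "- (z / A) \<noteq> 0" using nz[OF that(1)] \<open>A \<noteq> 0\<close> by simp
    then show "z = - (A * exp (Ln (- (z / A))))" using \<open>A \<noteq> 0\<close> by (subst exp_Ln) auto
    have "Ln (- (z / A)) - \<kappa> = Ln (- (z / B))"
      unfolding that(2)[symmetric] by (simp only: diff_diff_eq2 add_diff_cancel_left')
    then show "Ln (- (z / A)) \<in> S"
      unfolding S_def using Im[of A z] Im[of B z] that assms by (simp only: mem_Collect_eq) auto
  qed
  show ?thesis
    unfolding connected_component_def
    using conn sub mem[OF C] mem[OF D] eq by (metis \<kappa>_def)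
qed

text \<open>For \<open>z\<close> off both rays, \<open>Ln (- (z / A)) - Ln (- (z / B))\<close> is a
  logarithm of B / A, so its values at \<open>C\<close> and \<open>D\<close> differ by 2 pi i k.
  Their imaginary parts are below 2 pi in absolute value, which forces |k| < 2, and k = 0 would put
  \<open>C\<close> and \<open>D\<close> into one component. So k is 1 or -1.\<close>

lemma separated_rays_odd:
  fixes A B C D :: complex
  assumes C: "C \<notin> ray A \<union> ray B" and D: "D \<notin> ray A \<union> ray B"
    and sep: "\<not> connected_component (- (ray A \<union> ray B)) C D"
  shows "A \<noteq> 0" "B \<noteq> 0"
    "\<exists>k::int. odd k \<and> Ln (- (C / A)) - Ln (- (C / B)) - (Ln (- (D / A)) - Ln (- (D / B))) = of_int k * (2 * pi * \<i>)"
proof -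
  \<comment> \<open>The complement of a single ray is connected: with both rays equal, the logarithm
    differences of \<open>connected_component_via_strip\<close> vanish. This excludes a zero
    \<open>A\<close> or \<open>B\<close>, whose ray {0} lies in the other ray.\<close>
  have one: "connected_component (- ray X) C D" if "C \<notin> ray X" "D \<notin> ray X" for X :: complex
  proof (cases "X = 0")
    case True
    then have "ray X = {0}" by (auto simp: ray_def)
    then show ?thesis
      using connected_punctured_universe[of "0::complex"] that by (simp add: connected_iff_connected_component)
  next
    case False
    then show ?thesis using connected_component_via_strip[of X X C D] that by simp
  qed
  have "ray 0 = {0::complex}" by (auto simp: ray_def)
  then have r0: "ray 0 \<union> ray X = ray X" "ray X \<union> ray 0 = ray X" for X :: complex
    using ray_zero[of X] by auto
  show A0: "A \<noteq> 0"
  proof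
    assume "A = 0"
    then have "ray A \<union> ray B = ray B" by (simp add: r0)
    then show False using one[of B] C D sep by metis
  qed
  show B0: "B \<noteq> 0"
  proof
    assume "B = 0"
    then have "ray A \<union> ray B = ray A" by (simp add: r0)
    then show False using one[of A] C D sep by metis
  qed
  define \<nu> where "\<nu> z = Ln (- (z / A)) - Ln (- (z / B))" for z
  have nz: "C \<noteq> 0" "D \<noteq> 0" using C D ray_zero by auto
  have "exp (\<nu> C) = exp (\<nu> D)"
    using nz A0 B0 by (simp add: \<nu>_def exp_diff)
  then obtain k :: int where k: "\<nu> C = \<nu> D + (of_int (2 * k) * pi) * \<i>" unfolding exp_eq by blast
  have "k \<noteq> 0" using connected_component_via_strip[OF A0 B0 C D] sep k by (auto simp: \<nu>_def)
  have Im: "\<bar>Im (Ln (- (z / X)))\<bar> < pi" if "X \<noteq> 0" "z \<notin> ray X" for X z :: complex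
    by (intro abs_Im_Ln_less_pi minus_divide_notin_nonpos_Reals that)
  have "\<bar>Im (\<nu> C)\<bar> < 2 * pi" "\<bar>Im (\<nu> D)\<bar> < 2 * pi"
    using Im[of A C] Im[of B C] Im[of A D] Im[of B D] A0 B0 C D by (auto simp: \<nu>_def)
  moreover have "Im (\<nu> C) = Im (\<nu> D) + 2 * pi * k" using k by simp
  ultimately have "\<bar>2 * pi * k\<bar> < 4 * pi" by linarith
  then have "\<bar>real_of_int k\<bar> < 2" by (simp add: abs_mult)
  then have "\<bar>k\<bar> < 2" by linarith
  with \<open>k \<noteq> 0\<close> have "k = 1 \<or> k = -1" by linarith
  then have "odd k" by auto
  with k show "\<exists>k::int. odd k \<and> Ln (- (C / A)) - Ln (- (C / B)) - (Ln (- (D / A)) - Ln (- (D / B))) = of_int k * (2 * pi * \<i>)"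
    by (intro exI[of _ k]) (simp add: \<nu>_def algebra_simps)
qed

text \<open>The first-order model of a branch that may have a corner: a broken line through 0 that
  runs along \<open>A\<close> for positive \<open>u\<close> and along \<open>B\<close> for negative
  \<open>u\<close>. With B = - A it is a straight line.\<close>

definition corner :: "'a::real_vector \<Rightarrow> 'a \<Rightarrow> real \<Rightarrow> 'a" where
  "corner A B u = max u 0 *\<^sub>R A + max (- u) 0 *\<^sub>R B"

lemma corner_nonneg: "0 \<le> u \<Longrightarrow> corner A B u = u *\<^sub>R A"
  and corner_nonpos: "u \<le> 0 \<Longrightarrow> corner A B u = (- u) *\<^sub>R B"
  by (auto simp: corner_def max_def)

lemma corner_scale: "0 \<le> r \<Longrightarrow> corner A B (r * u) = r *\<^sub>R corner A B u"
  by (cases "0 \<le> u") (auto simp: corner_nonneg corner_nonpos mult_nonneg_nonpos)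

lemma continuous_on_corner [continuous_intros]:
  fixes A B :: "'a::real_normed_vector"
  shows "continuous_on S f \<Longrightarrow> continuous_on S (\<lambda>x. corner A B (f x))"
  unfolding corner_def by (intro continuous_intros)

definition corner_tangents :: "(real \<Rightarrow> 'a::real_normed_vector) \<Rightarrow> real \<Rightarrow> 'a \<Rightarrow> 'a \<Rightarrow> bool" where
  "corner_tangents g p A B \<longleftrightarrow>
     (\<forall>\<epsilon>>0. \<exists>\<delta>>0. \<forall>u. \<bar>u\<bar> \<le> \<delta> \<longrightarrow> norm (g (p + u) - g p - corner A B u) \<le> \<epsilon> * \<bar>u\<bar>)"

text \<open>Each side is halved where the moving branch passes 0, and
  \<open>log_change_two_rays\<close> applies to both halves. The values at the corners of the square
  and at the midpoints of its vertical sides cancel; the midpoints of the horizontal sides leave the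
  four terms of the result.\<close>

lemma rect_log_change_corners:
  fixes A B C D :: complex
  assumes "0 < \<delta>" "A \<noteq> 0" "B \<noteq> 0" and C: "C \<notin> ray A \<union> ray B" and D: "D \<notin> ray A \<union> ray B"
    and G: "G = (\<lambda>s t. corner A B (s - p) - corner C D (t - q))"
    and nz: "\<And>u v. (u, v) \<noteq> (0, 0) \<Longrightarrow> corner A B u \<noteq> corner C D v"
  shows "rect_log_change G (p - \<delta>) (p + \<delta>) (q - \<delta>) (q + \<delta>) =
    Ln (- (C / A)) - Ln (- (C / B)) - (Ln (- (D / A)) - Ln (- (D / B)))"
proof -
  have scale: "Ln (0 - complex_of_real \<delta> * (Y / X)) = Ln (complex_of_real \<delta>) + Ln (- (Y / X))" if "X \<noteq> 0" "Y \<noteq> 0" for X Y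
    using Ln_times_of_real[OF \<open>0 < \<delta>\<close>, of "- (Y / X)"] that by simp
  have C0: "C \<noteq> 0" and D0: "D \<noteq> 0" using C D ray_zero by auto
  have cont: "continuous_on S (G s)" "continuous_on S (\<lambda>s. G s t)" for s t S
    unfolding G by (intro continuous_intros)+
  have nzG: "G s t \<noteq> 0" if "s \<noteq> p \<or> t \<noteq> q" for s t
    unfolding G using nz[of "s - p" "t - q"] that by auto
  have right: "log_change (G (p + \<delta>)) (q - \<delta>) (q + \<delta>) =
     Ln (\<delta> - 0 * (D / A)) - Ln (\<delta> - \<delta> * (D / A)) + (Ln (\<delta> - \<delta> * (C / A)) - Ln (\<delta> - 0 * (C / A)))"
  proof -
    have "log_change (G (p + \<delta>)) (q - \<delta>) q =
       Ln (complex_of_real \<delta> - complex_of_real (q - q) * (D / A)) - Ln (complex_of_real \<delta> - complex_of_real (q - (q - \<delta>)) * (D / A))"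
      by (rule log_change_two_rays) (use assms in \<open>auto intro!: continuous_intros simp: corner_nonneg corner_nonpos\<close>)
    moreover have "log_change (G (p + \<delta>)) q (q + \<delta>) =
       Ln (complex_of_real \<delta> - complex_of_real (q + \<delta> - q) * (C / A)) - Ln (complex_of_real \<delta> - complex_of_real (q - q) * (C / A))"
      by (rule log_change_two_rays) (use assms in \<open>auto intro!: continuous_intros simp: corner_nonneg corner_nonpos\<close>)
    moreover have "log_change (G (p + \<delta>)) (q - \<delta>) (q + \<delta>) = log_change (G (p + \<delta>)) (q - \<delta>) q + log_change (G (p + \<delta>)) q (q + \<delta>)"
      by (rule log_change_combine[OF cont(1) nzG]) (use \<open>0 < \<delta>\<close> in auto)
    ultimately show ?thesis by simp
  qed
  have left: "log_change (G (p - \<delta>)) (q - \<delta>) (q + \<delta>) =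
     Ln (\<delta> - 0 * (D / B)) - Ln (\<delta> - \<delta> * (D / B)) + (Ln (\<delta> - \<delta> * (C / B)) - Ln (\<delta> - 0 * (C / B)))"
  proof -
    have "log_change (G (p - \<delta>)) (q - \<delta>) q =
       Ln (complex_of_real \<delta> - complex_of_real (q - q) * (D / B)) - Ln (complex_of_real \<delta> - complex_of_real (q - (q - \<delta>)) * (D / B))"
      by (rule log_change_two_rays) (use assms in \<open>auto intro!: continuous_intros simp: corner_nonneg corner_nonpos\<close>)
    moreover have "log_change (G (p - \<delta>)) q (q + \<delta>) =
       Ln (complex_of_real \<delta> - complex_of_real (q + \<delta> - q) * (C / B)) - Ln (complex_of_real \<delta> - complex_of_real (q - q) * (C / B))"
      by (rule log_change_two_rays) (use assms in \<open>auto intro!: continuous_intros simp: corner_nonneg corner_nonpos\<close>)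
    moreover have "log_change (G (p - \<delta>)) (q - \<delta>) (q + \<delta>) = log_change (G (p - \<delta>)) (q - \<delta>) q + log_change (G (p - \<delta>)) q (q + \<delta>)"
      by (rule log_change_combine[OF cont(1) nzG]) (use \<open>0 < \<delta>\<close> in auto)
    ultimately show ?thesis by simp
  qed
  have top: "log_change (\<lambda>s. G s (q + \<delta>)) (p - \<delta>) (p + \<delta>) =
     Ln (0 - \<delta> * (C / B)) - Ln (\<delta> - \<delta> * (C / B)) + (Ln (\<delta> - \<delta> * (C / A)) - Ln (0 - \<delta> * (C / A)))"
  proof -
    have "log_change (\<lambda>s. G s (q + \<delta>)) (p - \<delta>) p =
       Ln (complex_of_real (p - p) - complex_of_real \<delta> * (C / B)) - Ln (complex_of_real (p - (p - \<delta>)) - complex_of_real \<delta> * (C / B))"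
      by (rule log_change_two_rays) (use assms in \<open>auto intro!: continuous_intros simp: corner_nonneg corner_nonpos\<close>)
    moreover have "log_change (\<lambda>s. G s (q + \<delta>)) p (p + \<delta>) =
       Ln (complex_of_real (p + \<delta> - p) - complex_of_real \<delta> * (C / A)) - Ln (complex_of_real (p - p) - complex_of_real \<delta> * (C / A))"
      by (rule log_change_two_rays) (use assms in \<open>auto intro!: continuous_intros simp: corner_nonneg corner_nonpos\<close>)
    moreover have "log_change (\<lambda>s. G s (q + \<delta>)) (p - \<delta>) (p + \<delta>) = log_change (\<lambda>s. G s (q + \<delta>)) (p - \<delta>) p + log_change (\<lambda>s. G s (q + \<delta>)) p (p + \<delta>)"
      by (rule log_change_combine[OF cont(2) nzG]) (use \<open>0 < \<delta>\<close> in auto)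
    ultimately show ?thesis by simp
  qed
  have bottom: "log_change (\<lambda>s. G s (q - \<delta>)) (p - \<delta>) (p + \<delta>) =
     Ln (0 - \<delta> * (D / B)) - Ln (\<delta> - \<delta> * (D / B)) + (Ln (\<delta> - \<delta> * (D / A)) - Ln (0 - \<delta> * (D / A)))"
  proof -
    have "log_change (\<lambda>s. G s (q - \<delta>)) (p - \<delta>) p =
       Ln (complex_of_real (p - p) - complex_of_real \<delta> * (D / B)) - Ln (complex_of_real (p - (p - \<delta>)) - complex_of_real \<delta> * (D / B))"
      by (rule log_change_two_rays) (use assms in \<open>auto intro!: continuous_intros simp: corner_nonneg corner_nonpos\<close>)
    moreover have "log_change (\<lambda>s. G s (q - \<delta>)) p (p + \<delta>) =
       Ln (complex_of_real (p + \<delta> - p) - complex_of_real \<delta> * (D / A)) - Ln (complex_of_real (p - p) - complex_of_real \<delta> * (D / A))"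
      by (rule log_change_two_rays) (use assms in \<open>auto intro!: continuous_intros simp: corner_nonneg corner_nonpos\<close>)
    moreover have "log_change (\<lambda>s. G s (q - \<delta>)) (p - \<delta>) (p + \<delta>) = log_change (\<lambda>s. G s (q - \<delta>)) (p - \<delta>) p + log_change (\<lambda>s. G s (q - \<delta>)) p (p + \<delta>)"
      by (rule log_change_combine[OF cont(2) nzG]) (use \<open>0 < \<delta>\<close> in auto)
    ultimately show ?thesis by simp
  qed
  show ?thesis
    unfolding rect_log_change_def right left top bottom
      scale[OF \<open>A \<noteq> 0\<close> C0] scale[OF \<open>A \<noteq> 0\<close> D0] scale[OF \<open>B \<noteq> 0\<close> C0] scale[OF \<open>B \<noteq> 0\<close> D0]
    by (simp add: algebra_simps)
qed

lemma corners_disjoint: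
  assumes "A \<noteq> 0" "B \<noteq> 0" and C: "C \<notin> ray A \<union> ray B" and D: "D \<notin> ray A \<union> ray B" and "(u, v) \<noteq> (0, 0)"
  shows "corner A B u \<noteq> corner C D v"
proof
  assume eq: "corner A B u = corner C D v"
  obtain X where X: "X \<in> {A, B}" "corner A B u = \<bar>u\<bar> *\<^sub>R X"
    by (cases "0 \<le> u") (auto simp: corner_nonneg corner_nonpos)
  obtain Y where Y: "Y \<in> {C, D}" "corner C D v = \<bar>v\<bar> *\<^sub>R Y"
    by (cases "0 \<le> v") (auto simp: corner_nonneg corner_nonpos)
  have e: "\<bar>u\<bar> *\<^sub>R X = \<bar>v\<bar> *\<^sub>R Y" using X Y eq by simp
  show False
  proof (cases "v = 0")
    case True
    with e X assms show False by auto
  next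
    case False
    then have "Y = (1 / \<bar>v\<bar>) *\<^sub>R (\<bar>v\<bar> *\<^sub>R Y)" by simp
    also have "\<dots> = (\<bar>u\<bar> / \<bar>v\<bar>) *\<^sub>R X" unfolding e[symmetric] by simp
    also have "\<dots> \<in> ray X" by (rule ray_scaleR) simp
    finally show False using X Y C D by auto
  qed
qed

text \<open>On the boundary of a small square the difference of the two branches is close to the
  difference of their broken lines, and the latter has odd winding number because the rays of one
  separate those of the other.\<close>

lemma odd_index_at_crossing:
  fixes g h :: "real \<Rightarrow> complex"
  assumes "0 < r" and g: "continuous_on {p - r..p + r} g" and h: "continuous_on {q - r..q + r} h"
    and gh: "g p = h q" and AB: "corner_tangents g p A B" and CD: "corner_tangents h q C D"
    and C: "C \<notin> ray A \<union> ray B" and D: "D \<notin> ray A \<union> ray B"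
    and sep: "\<not> connected_component (- (ray A \<union> ray B)) C D"
  shows "odd_index_at (\<lambda>s t. g s - h t) p q"
proof -
  note A0 = separated_rays_odd(1)[OF C D sep] and B0 = separated_rays_odd(2)[OF C D sep]
  note nz = corners_disjoint[OF A0 B0 C D]
  \<comment> \<open>The boundary of the unit square. The model is positively homogeneous, so its
    least norm \<open>m\<close> on this set gives the lower bound \<delta> * m on the boundary of
    the square of half-width \<delta>.\<close>
  define S where "S = {-1, 1} \<times> {-1..1::real} \<union> {-1..1::real} \<times> {-1, 1::real}"
  have "compact S" unfolding S_def by (intro compact_Un compact_Times) auto
  moreover have "S \<noteq> {}" by (auto simp: S_def)
  moreover have "continuous_on S (\<lambda>z. norm (corner A B (fst z) - corner C D (snd z)))"
    by (intro continuous_intros)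
  ultimately have "\<exists>z0\<in>S. \<forall>z\<in>S.
      norm (corner A B (fst z0) - corner C D (snd z0)) \<le> norm (corner A B (fst z) - corner C D (snd z))"
    by (rule continuous_attains_inf)
  then obtain z0 where z0: "z0 \<in> S" "\<And>z. z \<in> S \<Longrightarrow>
      norm (corner A B (fst z0) - corner C D (snd z0)) \<le> norm (corner A B (fst z) - corner C D (snd z))"
    by blast
  define m where "m = norm (corner A B (fst z0) - corner C D (snd z0))"
  have "m > 0" unfolding m_def using z0(1) nz[of "fst z0" "snd z0"] by (auto simp: S_def)
  \<comment> \<open>One third for each branch: the total error is at most 2/3 of \<delta> * m and
    thus strictly below the norm of the model, as Rouche's comparison requires.\<close>
  then have "m / 3 > 0" by simp
  obtain \<delta>1 where \<delta>1: "\<delta>1 > 0" "\<And>u. \<bar>u\<bar> \<le> \<delta>1 \<Longrightarrow> norm (g (p + u) - g p - corner A B u) \<le> m / 3 * \<bar>u\<bar>"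
    using AB \<open>m / 3 > 0\<close> unfolding corner_tangents_def by meson
  obtain \<delta>2 where \<delta>2: "\<delta>2 > 0" "\<And>u. \<bar>u\<bar> \<le> \<delta>2 \<Longrightarrow> norm (h (q + u) - h q - corner C D u) \<le> m / 3 * \<bar>u\<bar>"
    using CD \<open>m / 3 > 0\<close> unfolding corner_tangents_def by meson
  define G where "G = (\<lambda>s t. corner A B (s - p) - corner C D (t - q))"
  have main: "rect_log_change (\<lambda>s t. g s - h t) (p - \<delta>) (p + \<delta>) (q - \<delta>) (q + \<delta>) =
      Ln (- (C / A)) - Ln (- (C / B)) - (Ln (- (D / A)) - Ln (- (D / B)))"
    if \<delta>: "0 < \<delta>" "\<delta> \<le> min r (min \<delta>1 \<delta>2)" for \<delta>
  proof -
    have "rect_log_change (\<lambda>s t. g s - h t) (p - \<delta>) (p + \<delta>) (q - \<delta>) (q + \<delta>) =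
        rect_log_change G (p - \<delta>) (p + \<delta>) (q - \<delta>) (q + \<delta>)"
    proof (rule rect_log_change_perturb)
      show "continuous_on ({p - \<delta>..p + \<delta>} \<times> {q - \<delta>..q + \<delta>}) (\<lambda>(s, t). g s - h t)"
        unfolding case_prod_beta using \<delta>
        by (intro continuous_intros continuous_on_compose2[OF g] continuous_on_compose2[OF h]) auto
      show "continuous_on ({p - \<delta>..p + \<delta>} \<times> {q - \<delta>..q + \<delta>}) (\<lambda>(s, t). G s t)"
        unfolding case_prod_beta G_def by (intro continuous_intros)
      show "norm (g s - h t - G s t) < norm (G s t)"
        if st: "s \<in> {p - \<delta>..p + \<delta>}" "t \<in> {q - \<delta>..q + \<delta>}" "s \<in> {p - \<delta>, p + \<delta>} \<or> t \<in> {q - \<delta>, q + \<delta>}" for s t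
      proof -
        have "norm (g (p + (s - p)) - g p - corner A B (s - p)) \<le> m / 3 * \<bar>s - p\<bar>"
          using \<delta> st by (intro \<delta>1(2)) auto
        also have "\<dots> \<le> m / 3 * \<delta>" using \<open>m / 3 > 0\<close> st by (intro mult_left_mono) auto
        finally have 1: "norm (g s - g p - corner A B (s - p)) \<le> m / 3 * \<delta>" by simp
        have "norm (h (q + (t - q)) - h q - corner C D (t - q)) \<le> m / 3 * \<bar>t - q\<bar>"
          using \<delta> st by (intro \<delta>2(2)) auto
        also have "\<dots> \<le> m / 3 * \<delta>" using \<open>m / 3 > 0\<close> st by (intro mult_left_mono) auto
        finally have 2: "norm (h t - h q - corner C D (t - q)) \<le> m / 3 * \<delta>" by simp
        have eq: "g s - h t - G s t = (g s - g p - corner A B (s - p)) - (h t - h q - corner C D (t - q))"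
          using gh by (simp add: G_def)
        have "norm (g s - h t - G s t) \<le> norm (g s - g p - corner A B (s - p)) + norm (h t - h q - corner C D (t - q))"
          unfolding eq by (rule norm_triangle_ineq4)
        then have 3: "norm (g s - h t - G s t) \<le> m / 3 * \<delta> + m / 3 * \<delta>" using 1 2 by linarith
        define u where "u = (s - p) / \<delta>"
        define v where "v = (t - q) / \<delta>"
        have uv: "s - p = \<delta> * u" "t - q = \<delta> * v" using \<delta> by (auto simp: u_def v_def)
        have "(u, v) \<in> S" using st \<delta> by (auto simp: S_def u_def v_def field_simps)
        then have "m \<le> norm (corner A B u - corner C D v)" using z0(2) unfolding m_def by fastforce
        moreover have "G s t = \<delta> *\<^sub>R (corner A B u - corner C D v)"
          unfolding G_def uv using \<delta> by (simp add: corner_scale algebra_simps)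
        ultimately have "\<delta> * m \<le> norm (G s t)" using \<delta> by simp
        moreover have "m / 3 * \<delta> + m / 3 * \<delta> < \<delta> * m" using \<delta> \<open>m > 0\<close> by (simp add: field_simps)
        ultimately show ?thesis using 3 by linarith
      qed
    qed (use \<delta> in auto)
    also have "\<dots> = Ln (- (C / A)) - Ln (- (C / B)) - (Ln (- (D / A)) - Ln (- (D / B)))"
      by (rule rect_log_change_corners[OF \<delta>(1) A0 B0 C D G_def nz])
    finally show ?thesis .
  qed
  show ?thesis
    unfolding odd_index_at_def
    by (intro exI[of _ "min r (min \<delta>1 \<delta>2)"])
       (use main separated_rays_odd(3)[OF C D sep] \<open>0 < r\<close> \<delta>1(1) \<delta>2(1) in auto)
qed

section \<open>Crossings of two edges\<close>

lemma has_vector_derivative_right_estimate: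
  fixes \<gamma> :: "real \<Rightarrow> 'a::real_normed_vector"
  assumes "(\<gamma> has_vector_derivative A) (at 0 within {0..1})" "0 < \<epsilon>"
  obtains \<delta> where "0 < \<delta>" "\<And>t. 0 \<le> t \<Longrightarrow> t \<le> \<delta> \<Longrightarrow> norm (\<gamma> t - \<gamma> 0 - t *\<^sub>R A) \<le> \<epsilon> * t"
proof -
  obtain d where d: "d > 0"
    "\<And>y. y \<in> {0..1} \<Longrightarrow> norm (y - 0) < d \<Longrightarrow> norm (\<gamma> y - \<gamma> 0 - (y - 0) *\<^sub>R A) \<le> \<epsilon> * norm (y - 0)"
    using assms unfolding has_vector_derivative_def has_derivative_within_alt by blast
  show thesis
  proof (rule that[of "min 1 (d / 2)"])
    show "norm (\<gamma> t - \<gamma> 0 - t *\<^sub>R A) \<le> \<epsilon> * t" if "0 \<le> t" "t \<le> min 1 (d / 2)" for t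
      using d(2)[of t] that d(1) by simp
  qed (use d in simp)
qed

text \<open>The given derivatives belong to unit-time runs from the point towards the two end
  vertices, which cover lengths \<open>a\<close> and \<open>b\<close> of the edge parameter;
  dividing by these lengths gives the speeds in that parameter.\<close>

lemma corner_tangentsI:
  fixes g :: "real \<Rightarrow> 'a::real_normed_vector"
  assumes "0 < a" "0 < b"
    and A: "((\<lambda>t. g (p + a * t)) has_vector_derivative A) (at 0 within {0..1})"
    and B: "((\<lambda>t. g (p - b * t)) has_vector_derivative B) (at 0 within {0..1})"
  shows "corner_tangents g p (A /\<^sub>R a) (B /\<^sub>R b)"
  unfolding corner_tangents_def
proof (intro allI impI)
  fix \<epsilon> :: real assume "0 < \<epsilon>"
  obtain \<delta>1 where \<delta>1: "0 < \<delta>1"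
    "\<And>t. 0 \<le> t \<Longrightarrow> t \<le> \<delta>1 \<Longrightarrow> norm (g (p + a * t) - g (p + a * 0) - t *\<^sub>R A) \<le> (\<epsilon> * a) * t"
    using has_vector_derivative_right_estimate[OF A, of "\<epsilon> * a"] \<open>0 < \<epsilon>\<close> \<open>0 < a\<close> by auto
  obtain \<delta>2 where \<delta>2: "0 < \<delta>2"
    "\<And>t. 0 \<le> t \<Longrightarrow> t \<le> \<delta>2 \<Longrightarrow> norm (g (p - b * t) - g (p - b * 0) - t *\<^sub>R B) \<le> (\<epsilon> * b) * t"
    using has_vector_derivative_right_estimate[OF B, of "\<epsilon> * b"] \<open>0 < \<epsilon>\<close> \<open>0 < b\<close> by auto
  show "\<exists>\<delta>>0. \<forall>u. \<bar>u\<bar> \<le> \<delta> \<longrightarrow> norm (g (p + u) - g p - corner (A /\<^sub>R a) (B /\<^sub>R b) u) \<le> \<epsilon> * \<bar>u\<bar>"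
  proof (intro exI[of _ "min (a * \<delta>1) (b * \<delta>2)"] conjI allI impI)
    fix u :: real assume u: "\<bar>u\<bar> \<le> min (a * \<delta>1) (b * \<delta>2)"
    show "norm (g (p + u) - g p - corner (A /\<^sub>R a) (B /\<^sub>R b) u) \<le> \<epsilon> * \<bar>u\<bar>"
    proof (cases "0 \<le> u")
      case True
      then show ?thesis
        using \<delta>1(2)[of "u / a"] u \<open>0 < a\<close> by (simp add: corner_nonneg field_simps)
    next
      case False
      then show ?thesis
        using \<delta>2(2)[of "- u / b"] u \<open>0 < b\<close> by (simp add: corner_nonpos field_simps)
    qed
  qed (use assms \<delta>1 \<delta>2 in simp)
qed

section \<open>Barycentric coordinates in the geometric realization\<close>

lemma linepath_vpoint_nth:
  "linepath (vpoint x) (vpoint y) \<sigma> $ w = (if w = x then 1 - \<sigma> else 0) + (if w = y then \<sigma> else 0)"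
  by (simp add: linepath_def vpoint_def axis_def)

lemma edge_cell_eq: "edge_cell {x, y} = linepath (vpoint x) (vpoint y) ` {0..1}"
  by (simp add: edge_cell_def segment_convex_hull[symmetric] linepath_image_01)

lemma inj_linepath_vpoint:
  assumes "x \<noteq> y" "linepath (vpoint x) (vpoint y) \<sigma> = linepath (vpoint x) (vpoint y) \<tau>"
  shows "\<sigma> = \<tau>"
  using arg_cong[OF assms(2), of "\<lambda>p. p $ y"] assms(1) unfolding linepath_vpoint_nth by simp

lemma edge_cell_support: "card e = 2 \<Longrightarrow> p \<in> edge_cell e \<Longrightarrow> p $ w \<noteq> 0 \<Longrightarrow> w \<in> e"
  by (auto simp: card_2_iff edge_cell_eq linepath_vpoint_nth split: if_splits)

lemma edge_cell_nonzero: "card e = 2 \<Longrightarrow> p \<in> edge_cell e \<Longrightarrow> \<exists>w\<in>e. p $ w \<noteq> 0"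
  by (auto simp: card_2_iff edge_cell_eq linepath_vpoint_nth)

lemma edge_interior_eq:
  assumes "x \<noteq> y"
  shows "edge_interior {x, y} = linepath (vpoint x) (vpoint y) ` {0<..<1}"
proof -
  have ends: "vpoint x = linepath (vpoint x) (vpoint y) 0" "vpoint y = linepath (vpoint x) (vpoint y) 1"
    by (auto simp: linepath_def)
  have "\<sigma> = 0 \<longleftrightarrow> linepath (vpoint x) (vpoint y) \<sigma> = vpoint x" "\<sigma> = 1 \<longleftrightarrow> linepath (vpoint x) (vpoint y) \<sigma> = vpoint y" for \<sigma>
    using inj_linepath_vpoint[OF assms] ends by metis+
  then show ?thesis
    unfolding edge_interior_def edge_cell_eq by (auto simp: less_le)
qed

lemma edge_interior_support: "card e = 2 \<Longrightarrow> p \<in> edge_interior e \<Longrightarrow> w \<in> e \<Longrightarrow> p $ w \<noteq> 0"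
  by (auto simp: card_2_iff edge_interior_eq linepath_vpoint_nth)

text \<open>The coordinates of an interior point of \<open>d\<close> are nonzero at both ends of
  \<open>d\<close>, while a point of the cell of \<open>e\<close> has nonzero coordinates only at
  ends of \<open>e\<close>; so one two-element set contains the other.\<close>

lemma edge_interior_unique:
  assumes "card d = 2" "card e = 2" "p \<in> edge_interior d" "p \<in> edge_cell e"
  shows "d = e"
proof (rule card_subset_eq)
  show "finite e" using assms card.infinite by force
  show "d \<subseteq> e"
    using edge_interior_support[OF assms(1,3)] edge_cell_support[OF assms(2,4)] by blast
qed (use assms in simp)

lemma edge_cells_disjoint:
  "card d = 2 \<Longrightarrow> card e = 2 \<Longrightarrow> d \<inter> e = {} \<Longrightarrow> p \<in> edge_cell d \<Longrightarrow> q \<in> edge_cell e \<Longrightarrow> p \<noteq> q"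
  using edge_cell_nonzero edge_cell_support by (metis disjoint_iff)

lemma vpoint_notin_edge_interior: "card d = 2 \<Longrightarrow> vpoint x \<notin> edge_interior d"
proof
  assume d: "card d = 2" and x: "vpoint x \<in> edge_interior d"
  have "w = x" if "w \<in> d" for w
    using edge_interior_support[OF d x that] by (auto simp: vpoint_def axis_def split: if_splits)
  then have "d \<subseteq> {x}" by auto
  then have "card d \<le> 1" by (metis card_mono card.empty card.insert finite.emptyI finite.insertI empty_iff One_nat_def)
  with d show False by simp
qed

lemma vpoint_notin_edge_cell: "card e = 2 \<Longrightarrow> x \<notin> e \<Longrightarrow> vpoint x \<notin> edge_cell e"
  using edge_cell_support[of e "vpoint x" x] by (auto simp: vpoint_def axis_def)

lemma edge_cell_subset: "e \<in> E \<Longrightarrow> edge_cell e \<subseteq> graph_space E"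
  by (auto simp: graph_space_def)

lemma ray_scale_eq: "0 < c \<Longrightarrow> ray (c *\<^sub>R A) = ray A"
proof -
  have sub: "ray (c *\<^sub>R A) \<subseteq> ray A" if "0 < c" for c and A :: 'a
  proof
    fix z assume "z \<in> ray (c *\<^sub>R A)"
    then obtain t where "0 \<le> t" "z = (t * c) *\<^sub>R A" by (auto simp: ray_def)
    then show "z \<in> ray A" using that by (simp add: ray_scaleR)
  qed
  assume "0 < c"
  then show ?thesis using sub[of c A] sub[of "1 / c" "c *\<^sub>R A"] by simp
qed

lemma rays_cross_swap_first: "rays_cross A B C D \<Longrightarrow> rays_cross B A C D"
  by (simp add: rays_cross_def Un_commute)

lemma rays_cross_swap_second: "rays_cross A B C D \<Longrightarrow> rays_cross A B D C"
  by (auto simp: rays_cross_def dest: connected_component_sym)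

text \<open>The definition lets the ends be named in either order; as \<open>rays_cross\<close> is
  symmetric in its first two and in its last two rays, a naming can be prescribed.\<close>

lemma transversal_at_tangents:
  assumes "transversal_at f {a, b} p {s, t} q"
  obtains A B C D where "tangent_towards f p b A" "tangent_towards f p a B"
    "tangent_towards f q t C" "tangent_towards f q s D" "rays_cross A B C D"
proof -
  obtain x y z w A B C D where *: "{a, b} = {x, y}" "{s, t} = {z, w}"
    "tangent_towards f p x A" "tangent_towards f p y B" "tangent_towards f q z C" "tangent_towards f q w D"
    "rays_cross A B C D" using assms unfolding transversal_at_def by blast
  obtain A' B' where AB: "tangent_towards f p b A'" "tangent_towards f p a B'" "rays_cross A' B' C D"
    using * rays_cross_swap_first by (metis doubleton_eq_iff)
  show thesis
    using AB * rays_cross_swap_second that by (metis doubleton_eq_iff)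
qed

lemma corner_tangents_edge:
  fixes \<phi> :: "real ^ 2 \<Rightarrow> complex"
  assumes "linear \<phi>" "0 < \<sigma>" "\<sigma> < 1"
    and A: "tangent_towards f (linepath (vpoint a) (vpoint b) \<sigma>) b A"
    and B: "tangent_towards f (linepath (vpoint a) (vpoint b) \<sigma>) a B"
  shows "corner_tangents (\<lambda>\<sigma>. \<phi> (f (linepath (vpoint a) (vpoint b) \<sigma>))) \<sigma>
    (\<phi> A /\<^sub>R (1 - \<sigma>)) (\<phi> B /\<^sub>R \<sigma>)"
proof (rule corner_tangentsI)
  let ?L = "linepath (vpoint a) (vpoint b)"
  have bl: "bounded_linear \<phi>" using assms(1) linear_conv_bounded_linear by blast
  have "linepath (?L \<sigma>) (vpoint b) = (\<lambda>t. ?L (\<sigma> + (1 - \<sigma>) * t))"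
    by (auto simp: linepath_def algebra_simps)
  then show "((\<lambda>t. \<phi> (f (?L (\<sigma> + (1 - \<sigma>) * t)))) has_vector_derivative \<phi> A) (at 0 within {0..1})"
    using bounded_linear.has_vector_derivative[OF bl A[unfolded tangent_towards_def]] by simp
  have "linepath (?L \<sigma>) (vpoint a) = (\<lambda>t. ?L (\<sigma> - \<sigma> * t))"
    by (auto simp: linepath_def algebra_simps)
  then show "((\<lambda>t. \<phi> (f (?L (\<sigma> - \<sigma> * t)))) has_vector_derivative \<phi> B) (at 0 within {0..1})"
    using bounded_linear.has_vector_derivative[OF bl B[unfolded tangent_towards_def]] by simp
qed (use assms in auto)

text \<open>A linear isomorphism maps rays to rays and preserves connectedness. The positive factors
  absorb the change from the tangents towards the end vertices to the speeds in the edge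
  parameter.\<close>

lemma rays_cross_transfer:
  fixes \<phi> :: "real ^ 2 \<Rightarrow> complex"
  assumes \<phi>: "linear \<phi>" "linear \<psi>" "\<And>x. \<psi> (\<phi> x) = x" "\<And>z. \<phi> (\<psi> z) = z"
    and cross: "rays_cross A B C D"
    and pos: "0 < \<alpha>" "0 < \<beta>" "0 < \<gamma>" "0 < \<delta>"
  shows "\<gamma> *\<^sub>R \<phi> C \<notin> ray (\<alpha> *\<^sub>R \<phi> A) \<union> ray (\<beta> *\<^sub>R \<phi> B)"
    and "\<delta> *\<^sub>R \<phi> D \<notin> ray (\<alpha> *\<^sub>R \<phi> A) \<union> ray (\<beta> *\<^sub>R \<phi> B)"
    and "\<not> connected_component (- (ray (\<alpha> *\<^sub>R \<phi> A) \<union> ray (\<beta> *\<^sub>R \<phi> B))) (\<gamma> *\<^sub>R \<phi> C) (\<delta> *\<^sub>R \<phi> D)"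
proof -
  have pull: "\<psi> z \<in> ray X" if "z \<in> ray (\<phi> X)" for z X
    using that \<phi> by (auto simp: ray_def linear_scale)
  have mem: "\<phi> X \<in> ray (\<phi> Y) \<longleftrightarrow> X \<in> ray Y" for X Y
    using pull[of "\<phi> X" Y] \<phi> by (auto simp: ray_def linear_scale)
  have scale: "c *\<^sub>R z \<in> ray X \<longleftrightarrow> z \<in> ray X" if "0 < c" for c z and X :: complex
  proof -
    have "d *\<^sub>R z \<in> ray X" if "0 < d" "z \<in> ray X" for d z
      using that by (force simp: ray_def)
    from this[of c z] this[of "1 / c" "c *\<^sub>R z"] that show ?thesis by auto
  qed
  let ?R = "ray (\<phi> A) \<union> ray (\<phi> B)"
  have R: "ray (\<alpha> *\<^sub>R \<phi> A) \<union> ray (\<beta> *\<^sub>R \<phi> B) = ?R" using pos by (simp add: ray_scale_eq)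
  have C: "\<phi> C \<notin> ?R" and D: "\<phi> D \<notin> ?R"
    using cross unfolding rays_cross_def by (auto simp: mem)
  show "\<gamma> *\<^sub>R \<phi> C \<notin> ray (\<alpha> *\<^sub>R \<phi> A) \<union> ray (\<beta> *\<^sub>R \<phi> B)"
    "\<delta> *\<^sub>R \<phi> D \<notin> ray (\<alpha> *\<^sub>R \<phi> A) \<union> ray (\<beta> *\<^sub>R \<phi> B)"
    unfolding R using C D pos by (auto simp: scale)
  \<comment> \<open>The complement of rays from 0 is invariant under positive scaling, so the
    segment from \<open>z\<close> to a positive multiple of \<open>z\<close> avoids them.\<close>
  have stretch: "connected_component (- ?R) z (c *\<^sub>R z)" if "z \<notin> ?R" "0 < c" for z c
  proof -
    have "closed_segment z (c *\<^sub>R z) \<subseteq> - ?R"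
    proof
      fix y assume "y \<in> closed_segment z (c *\<^sub>R z)"
      then obtain u where u: "0 \<le> u" "u \<le> 1" "y = ((1 - u) + u * c) *\<^sub>R z"
        by (auto simp: in_segment algebra_simps)
      have "(1 - u) + u * c > 0"
        using u that by (cases "u = 0") (auto intro: add_nonneg_pos)
      then show "y \<in> - ?R" using that(1) by (simp add: u(3) scale)
    qed
    then show ?thesis
      unfolding connected_component_def by (intro exI[of _ "closed_segment z (c *\<^sub>R z)"]) auto
  qed
  show "\<not> connected_component (- (ray (\<alpha> *\<^sub>R \<phi> A) \<union> ray (\<beta> *\<^sub>R \<phi> B))) (\<gamma> *\<^sub>R \<phi> C) (\<delta> *\<^sub>R \<phi> D)"
    unfolding R
  proof
    assume "connected_component (- ?R) (\<gamma> *\<^sub>R \<phi> C) (\<delta> *\<^sub>R \<phi> D)"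
    then have "connected_component (- ?R) (\<phi> C) (\<phi> D)"
      using stretch[OF C pos(3)] stretch[OF D pos(4)]
      by (meson connected_component_sym connected_component_trans)
    then obtain T where T: "connected T" "T \<subseteq> - ?R" "\<phi> C \<in> T" "\<phi> D \<in> T"
      unfolding connected_component_def by blast
    have "continuous_on T \<psi>" using \<phi>(2) by (simp add: linear_continuous_on linear_conv_bounded_linear[symmetric])
    then have "connected (\<psi> ` T)" using T(1) connected_continuous_image by blast
    moreover have "C \<in> \<psi> ` T" "D \<in> \<psi> ` T" using T \<phi>(3) by (metis imageI)+
    moreover have "\<psi> ` T \<subseteq> - (ray A \<union> ray B)"
      using T(2) mem \<phi>(4) by (auto 4 3 simp: subset_iff) (metis mem \<phi>(4))+
    ultimately show False using cross unfolding rays_cross_def connected_component_def by blast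
  qed
qed

text \<open>Double points lie in edge interiors, so a vertex shares its image with no other point.
  This is what keeps the difference between a vertex and a disjoint edge away from 0.\<close>

lemma generic_vertex_value:
  assumes "plane_generic_immersion E f" "\<forall>e\<in>E. card e = 2" "q \<in> graph_space E" "f (vpoint x) = f q"
  shows "q = vpoint x"
proof (rule ccontr)
  assume "q \<noteq> vpoint x"
  moreover have "vpoint x \<in> graph_space E" by (simp add: graph_space_def)
  ultimately obtain d where "d \<in> E" "vpoint x \<in> edge_interior d"
    using assms(1,3,4) unfolding plane_generic_immersion_def by metis
  then show False using vpoint_notin_edge_interior assms(2) by blast
qed

text \<open>The zeros in the parameter square correspond one for one to the common points of the two
  images, since a multiple value has exactly two preimages and disjoint edges share no point.
  Transversality gives each zero an odd index.\<close>

lemma edge_crossing_parity: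
  fixes \<phi> :: "real ^ 2 \<Rightarrow> complex"
  assumes f: "plane_generic_immersion E f" and E: "\<forall>e\<in>E. card e = 2"
    and \<phi>: "linear \<phi>" "linear \<psi>" "\<And>x. \<psi> (\<phi> x) = x" "\<And>z. \<phi> (\<psi> z) = z"
    and d: "{a, b} \<in> E" and e: "{s, t} \<in> E" and disj: "{a, b} \<inter> {s, t} = {}"
  shows "\<exists>k::int. rect_log_change
      (\<lambda>\<sigma> \<tau>. \<phi> (f (linepath (vpoint a) (vpoint b) \<sigma>)) - \<phi> (f (linepath (vpoint s) (vpoint t) \<tau>))) 0 1 0 1
      = of_int k * (2 * pi * \<i>) \<and>
    (odd k \<longleftrightarrow> odd (card (f ` edge_cell {a, b} \<inter> f ` edge_cell {s, t})))"
proof -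
  define K L where "K = linepath (vpoint a) (vpoint b)" and "L = linepath (vpoint s) (vpoint t)"
  define g h where "g \<sigma> = \<phi> (f (K \<sigma>))" and "h \<tau> = \<phi> (f (L \<tau>))" for \<sigma> \<tau>
  define Z where "Z = {(\<sigma>, \<tau>). \<sigma> \<in> {0..1} \<and> \<tau> \<in> {0..1} \<and> g \<sigma> - h \<tau> = 0}"
  have ab: "a \<noteq> b" and st: "s \<noteq> t" using E d e by (auto simp: card_2_iff doubleton_eq_iff)
  have c2: "card {a, b} = 2" "card {s, t} = 2" using E d e by auto
  have K: "K \<sigma> \<in> edge_cell {a, b}" "K \<sigma> \<in> graph_space E" if "\<sigma> \<in> {0..1}" for \<sigma>
    using that edge_cell_subset[OF d] by (auto simp: K_def edge_cell_eq)
  have L: "L \<tau> \<in> edge_cell {s, t}" "L \<tau> \<in> graph_space E" if "\<tau> \<in> {0..1}" for \<tau>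
    using that edge_cell_subset[OF e] by (auto simp: L_def edge_cell_eq)
  have KL: "K \<sigma> \<noteq> L \<tau>" if "\<sigma> \<in> {0..1}" "\<tau> \<in> {0..1}" for \<sigma> \<tau>
    using edge_cells_disjoint[OF c2 disj] K L that by blast
  have contf: "continuous_on (graph_space E) f"
    using f by (simp add: plane_generic_immersion_def plane_immersion_def)
  have cont\<phi>: "continuous_on UNIV \<phi>"
    using \<phi>(1) by (simp add: linear_continuous_on linear_conv_bounded_linear[symmetric])
  have gcont: "continuous_on {0..1} g"
    unfolding g_def
    by (rule continuous_on_compose2[OF cont\<phi>], rule continuous_on_compose2[OF contf])
       (use K in \<open>auto simp: K_def\<close>)
  have hcont: "continuous_on {0..1} h"
    unfolding h_def
    by (rule continuous_on_compose2[OF cont\<phi>], rule continuous_on_compose2[OF contf])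
       (use L in \<open>auto simp: L_def\<close>)
  have Zf: "(\<sigma>, \<tau>) \<in> Z \<longleftrightarrow> \<sigma> \<in> {0..1} \<and> \<tau> \<in> {0..1} \<and> f (K \<sigma>) = f (L \<tau>)" for \<sigma> \<tau>
  proof -
    have "g \<sigma> - h \<tau> = 0 \<longleftrightarrow> f (K \<sigma>) = f (L \<tau>)"
      unfolding g_def h_def right_minus_eq by (rule inj_eq) (rule inj_on_inverseI, rule \<phi>(3))
    then show ?thesis unfolding Z_def by blast
  qed
  note double = f[unfolded plane_generic_immersion_def, THEN conjunct2, THEN conjunct2, rule_format]
  have gen: "{r \<in> graph_space E. f r = f (K \<sigma>)} = {K \<sigma>, L \<tau>}"
      "\<exists>d'\<in>E. \<exists>e'\<in>E. K \<sigma> \<in> edge_interior d' \<and> L \<tau> \<in> edge_interior e' \<and> transversal_at f d' (K \<sigma>) e' (L \<tau>)"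
    if "(\<sigma>, \<tau>) \<in> Z" for \<sigma> \<tau>
  proof -
    have "\<sigma> \<in> {0..1}" "\<tau> \<in> {0..1}" "f (K \<sigma>) = f (L \<tau>)" using that by (auto simp only: Zf)
    note * = double[OF K(2)[OF this(1)] L(2)[OF this(2)] conjI[OF KL[OF this(1,2)] this(3)]]
    show "{r \<in> graph_space E. f r = f (K \<sigma>)} = {K \<sigma>, L \<tau>}" using * by (rule conjunct1)
    show "\<exists>d'\<in>E. \<exists>e'\<in>E. K \<sigma> \<in> edge_interior d' \<and> L \<tau> \<in> edge_interior e' \<and> transversal_at f d' (K \<sigma>) e' (L \<tau>)"
      using * by (rule conjunct2)
  qed
  \<comment> \<open>The fibre over a crossing is exactly {K \<sigma>, L \<tau>} and \<open>K\<close>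
    never meets \<open>L\<close>, so the crossing value determines both parameters. The same fact
    later yields injectivity of \<open>fst\<close> on \<open>Z\<close>.\<close>
  have uniq: "\<sigma>' = \<sigma> \<and> \<tau>' = \<tau>" if "(\<sigma>, \<tau>) \<in> Z" "(\<sigma>', \<tau>') \<in> Z" "f (K \<sigma>) = f (K \<sigma>')" for \<sigma> \<tau> \<sigma>' \<tau>'
  proof -
    have "K \<sigma>' \<in> {K \<sigma>, L \<tau>}" "L \<tau>' \<in> {K \<sigma>, L \<tau>}"
      using that K(2)[of \<sigma>'] L(2)[of \<tau>'] unfolding gen(1)[OF that(1), symmetric] by (auto simp: Zf)
    moreover have "K \<sigma>' \<noteq> L \<tau>" "L \<tau>' \<noteq> K \<sigma>" using KL that by (metis Zf)+
    ultimately have "K \<sigma>' = K \<sigma>" "L \<tau>' = L \<tau>" by auto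
    then show ?thesis
      using inj_linepath_vpoint[OF ab] inj_linepath_vpoint[OF st] unfolding K_def L_def by blast
  qed
  have img: "f ` edge_cell {a, b} \<inter> f ` edge_cell {s, t} = (\<lambda>z. f (K (fst z))) ` Z"
  proof (intro equalityI subsetI)
    fix y assume "y \<in> f ` edge_cell {a, b} \<inter> f ` edge_cell {s, t}"
    then obtain \<sigma> \<tau> where "\<sigma> \<in> {0..1}" "\<tau> \<in> {0..1}" "y = f (K \<sigma>)" "y = f (L \<tau>)"
      unfolding edge_cell_eq K_def L_def by blast
    then show "y \<in> (\<lambda>z. f (K (fst z))) ` Z" using Zf[of \<sigma> \<tau>] by force
  next
    fix y assume "y \<in> (\<lambda>z. f (K (fst z))) ` Z"
    then obtain \<sigma> \<tau> where "(\<sigma>, \<tau>) \<in> Z" "y = f (K \<sigma>)" by force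
    then show "y \<in> f ` edge_cell {a, b} \<inter> f ` edge_cell {s, t}"
      using K(1)[of \<sigma>] L(1)[of \<tau>] imageI[of _ _ f] unfolding Zf by (metis IntI)
  qed
  have inj: "inj_on (\<lambda>z. f (K (fst z))) Z"
    unfolding inj_on_def using uniq by (metis prod.collapse)
  have "(\<lambda>z. f (K (fst z))) ` Z \<subseteq> {f p | p q. p \<in> graph_space E \<and> q \<in> graph_space E \<and> p \<noteq> q \<and> f p = f q}"
  proof
    fix y assume "y \<in> (\<lambda>z. f (K (fst z))) ` Z"
    then obtain \<sigma> \<tau> where *: "(\<sigma>, \<tau>) \<in> Z" "y = f (K \<sigma>)" by force
    then show "y \<in> {f p | p q. p \<in> graph_space E \<and> q \<in> graph_space E \<and> p \<noteq> q \<and> f p = f q}"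
      using K(2)[of \<sigma>] L(2)[of \<tau>] KL[of \<sigma> \<tau>] Zf by blast
  qed
  then have "finite ((\<lambda>z. f (K (fst z))) ` Z)"
    using f finite_subset unfolding plane_generic_immersion_def by blast
  then have finZ: "finite Z" using inj finite_imageD by blast
  have cardZ: "card (f ` edge_cell {a, b} \<inter> f ` edge_cell {s, t}) = card Z"
    unfolding img using inj by (rule card_image)
  have cross: "0 < \<sigma> \<and> \<sigma> < 1 \<and> 0 < \<tau> \<and> \<tau> < 1 \<and> transversal_at f {a, b} (K \<sigma>) {s, t} (L \<tau>)"
    if z: "(\<sigma>, \<tau>) \<in> Z" for \<sigma> \<tau>
  proof -
    have mem: "\<sigma> \<in> {0..1}" "\<tau> \<in> {0..1}" using z by (auto simp: Zf)
    obtain d' e' where de: "d' \<in> E" "e' \<in> E" "K \<sigma> \<in> edge_interior d'" "L \<tau> \<in> edge_interior e'"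
      "transversal_at f d' (K \<sigma>) e' (L \<tau>)" using gen(2)[OF z] by blast
    \<comment> \<open>Genericity provides some edges with these interior points; an interior point
      lies in the cell of just one edge, so they are the two given ones, and the zero is in the open
      square.\<close>
    have "d' = {a, b}" "e' = {s, t}"
      using edge_interior_unique[OF _ c2(1) de(3) K(1)[OF mem(1)]]
        edge_interior_unique[OF _ c2(2) de(4) L(1)[OF mem(2)]] E de by auto
    moreover obtain \<sigma>' \<tau>' where "K \<sigma> = K \<sigma>'" "L \<tau> = L \<tau>'" "\<sigma>' \<in> {0<..<1}" "\<tau>' \<in> {0<..<1}"
      using de(3,4) unfolding calculation edge_interior_eq[OF ab] edge_interior_eq[OF st] K_def L_def by blast
    moreover have "\<sigma> = \<sigma>'" "\<tau> = \<tau>'"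
      using calculation inj_linepath_vpoint[OF ab] inj_linepath_vpoint[OF st] unfolding K_def L_def by blast+
    ultimately show ?thesis using de(5) by auto
  qed
  have index: "odd_index_at (\<lambda>\<sigma> \<tau>. g \<sigma> - h \<tau>) \<sigma> \<tau>" if z: "(\<sigma>, \<tau>) \<in> Z" for \<sigma> \<tau>
  proof -
    have r: "0 < \<sigma>" "\<sigma> < 1" "0 < \<tau>" "\<tau> < 1" and tr: "transversal_at f {a, b} (K \<sigma>) {s, t} (L \<tau>)"
      using cross[OF z] by auto
    obtain A B C D where T: "tangent_towards f (K \<sigma>) b A" "tangent_towards f (K \<sigma>) a B"
      "tangent_towards f (L \<tau>) t C" "tangent_towards f (L \<tau>) s D" "rays_cross A B C D"
      using transversal_at_tangents[OF tr] by blast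
    define r where "r = min (min \<sigma> (1 - \<sigma>)) (min \<tau> (1 - \<tau>))"
    have le: "r \<le> \<sigma>" "r \<le> 1 - \<sigma>" "r \<le> \<tau>" "r \<le> 1 - \<tau>" by (auto simp: r_def min_def)
    have gt: "corner_tangents g \<sigma> (\<phi> A /\<^sub>R (1 - \<sigma>)) (\<phi> B /\<^sub>R \<sigma>)"
      unfolding g_def K_def using r T by (intro corner_tangents_edge \<phi>) (auto simp: K_def)
    have ht: "corner_tangents h \<tau> (\<phi> C /\<^sub>R (1 - \<tau>)) (\<phi> D /\<^sub>R \<tau>)"
      unfolding h_def L_def using r T by (intro corner_tangents_edge \<phi>) (auto simp: L_def)
    have pos: "0 < inverse (1 - \<sigma>)" "0 < inverse \<sigma>" "0 < inverse (1 - \<tau>)" "0 < inverse \<tau>" using r by auto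
    show ?thesis
    proof (rule odd_index_at_crossing[OF _ _ _ _ gt ht rays_cross_transfer[OF \<phi> T(5) pos]])
      show "0 < r" unfolding r_def using r by auto
      show "continuous_on {\<sigma> - r..\<sigma> + r} g"
        by (rule continuous_on_subset[OF gcont]) (use le in auto)
      show "continuous_on {\<tau> - r..\<tau> + r} h"
        by (rule continuous_on_subset[OF hcont]) (use le in auto)
      show "g \<sigma> = h \<tau>" using z by (simp add: Z_def)
    qed
  qed
  have "\<exists>k::int. rect_log_change (\<lambda>\<sigma> \<tau>. g \<sigma> - h \<tau>) 0 1 0 1 = of_int k * (2 * pi * \<i>) \<and> (odd k \<longleftrightarrow> odd (card Z))"
  proof (rule rect_log_change_parity[OF _ _ _ Z_def finZ])
    show "continuous_on ({0..1} \<times> {0..1}) (\<lambda>(\<sigma>, \<tau>). g \<sigma> - h \<tau>)"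
      unfolding case_prod_beta
      by (intro continuous_intros continuous_on_compose2[OF gcont] continuous_on_compose2[OF hcont]) auto
    show "inj_on fst Z" unfolding inj_on_def using uniq by (metis prod.collapse)
    show "Z \<subseteq> {0<..<1} \<times> {0<..<1}" using cross by auto
  qed (use index in auto)
  then show ?thesis unfolding cardZ g_def h_def K_def L_def .
qed

text \<open>For vertices placed on a circle in the order \<open>r\<close>, these are the pairs of
  edges whose chords cross.\<close>

definition interlaced :: "('v \<Rightarrow> nat) \<Rightarrow> 'v set \<Rightarrow> 'v set \<Rightarrow> bool" where
  "interlaced r d e \<longleftrightarrow> (\<exists>a b s t. d = {a, b} \<and> e = {s, t} \<and>
     (r a < r s \<and> r s < r b \<and> r b < r t \<or> r s < r a \<and> r a < r t \<and> r t < r b))"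

lemma interlaced_iff:
  assumes "r a < r b" "r s < r t"
  shows "interlaced r {a, b} {s, t} \<longleftrightarrow>
    r a < r s \<and> r s < r b \<and> r b < r t \<or> r s < r a \<and> r a < r t \<and> r t < r b"
proof
  assume "interlaced r {a, b} {s, t}"
  then show "r a < r s \<and> r s < r b \<and> r b < r t \<or> r s < r a \<and> r a < r t \<and> r t < r b"
    using assms unfolding interlaced_def doubleton_eq_iff by auto
qed (auto simp: interlaced_def)

text \<open>\<open>N x e\<close> counts the full turns by which the change of the logarithm along
  \<open>e\<close>, seen from \<open>x\<close>, differs from the difference of the logarithms chosen
  at its ends. It depends on \<open>x\<close> and \<open>e\<close> alone, so one \<open>N\<close>
  serves all pairs of edges.\<close>

lemma vertex_edge_parity:
  fixes f :: "real ^ 'v::finite \<Rightarrow> real ^ 2" and r :: "'v \<Rightarrow> nat"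
  assumes f: "plane_generic_immersion E f" and E: "\<forall>e\<in>E. card e = 2" and r: "inj r"
  obtains N :: "'v \<Rightarrow> 'v set \<Rightarrow> int" where
    "\<And>d e. d \<in> E \<Longrightarrow> e \<in> E \<Longrightarrow> d \<inter> e = {} \<Longrightarrow>
      odd (card (f ` edge_cell d \<inter> f ` edge_cell e)) \<longleftrightarrow>
      odd ((\<Sum>x\<in>d. N x e) + (\<Sum>x\<in>e. N x d) + of_bool (interlaced r d e))"
proof -
  \<comment> \<open>Any linear identification of the plane with the complex numbers will do:
    reversing the orientation changes only signs.\<close>
  obtain \<phi> :: "real ^ 2 \<Rightarrow> complex" and \<psi> where
    \<phi>: "linear \<phi>" "linear \<psi>" "\<And>x. \<psi> (\<phi> x) = x" "\<And>z. \<phi> (\<psi> z) = z"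
  proof -
    have "DIM(real ^ 2) = DIM(complex)" by simp
    then show ?thesis using isomorphisms_UNIV_UNIV that by metis
  qed
  define F where "F p = \<phi> (f p)" for p
  \<comment> \<open>The principal logarithm is used for one order of each pair only; for the other
    order pi i is added, so that \<alpha> y x - \<alpha> x y depends on the order of the two
    vertices and not on \<open>f\<close>.\<close>
  define \<alpha> where "\<alpha> x y = (if r x < r y then Ln (F (vpoint x) - F (vpoint y))
     else Ln (F (vpoint y) - F (vpoint x)) + pi * \<i>)" for x y
  define \<theta> where "\<theta> x s t = log_change (\<lambda>\<tau>. F (vpoint x) - F (linepath (vpoint s) (vpoint t) \<tau>)) 0 1" for x s t
  have Fneq: "F (vpoint x) \<noteq> F q" if "q \<in> graph_space E" "q \<noteq> vpoint x" for x q
    using generic_vertex_value[OF f E] that \<phi>(3) unfolding F_def by metis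
  have vg: "vpoint x \<in> graph_space E" for x by (simp add: graph_space_def)
  have vinj: "vpoint x \<noteq> vpoint y" if "x \<noteq> y" for x y :: 'v
    using that by (simp add: vpoint_def axis_eq_axis)
  have exp\<alpha>: "exp (\<alpha> x y) = F (vpoint x) - F (vpoint y)" if "x \<noteq> y" for x y
  proof -
    have "F (vpoint x) - F (vpoint y) \<noteq> 0" using Fneq[OF vg vinj] that by auto
    then show ?thesis by (auto simp: \<alpha>_def exp_add)
  qed
  have \<alpha>: "\<alpha> y x = \<alpha> x y + pi * \<i>" if "r x < r y" for x y using that by (simp add: \<alpha>_def)
  have contF: "continuous_on {0..1} (\<lambda>\<tau>. F (linepath (vpoint s) (vpoint t) \<tau>))" if "{s, t} \<in> E" for s t
  proof -
    have f': "continuous_on (graph_space E) f"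
      using f by (simp add: plane_generic_immersion_def plane_immersion_def)
    have \<phi>': "continuous_on UNIV \<phi>"
      using \<phi>(1) by (simp add: linear_continuous_on linear_conv_bounded_linear[symmetric])
    have sub: "linepath (vpoint s) (vpoint t) ` {0..1} \<subseteq> graph_space E"
      using edge_cell_subset[OF that] unfolding edge_cell_eq .
    show ?thesis
      unfolding F_def
      by (rule continuous_on_compose2[OF \<phi>' continuous_on_compose2[OF f' continuous_on_linepath sub]]) simp
  qed
  have nz: "F (vpoint x) - F (linepath (vpoint s) (vpoint t) \<tau>) \<noteq> 0"
    if "{s, t} \<in> E" "x \<notin> {s, t}" "\<tau> \<in> {0..1}" for x s t \<tau>
  proof -
    have "linepath (vpoint s) (vpoint t) \<tau> \<in> edge_cell {s, t}" using that(3) by (auto simp: edge_cell_eq)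
    moreover have "vpoint x \<notin> edge_cell {s, t}" using vpoint_notin_edge_cell E that by blast
    ultimately show ?thesis using Fneq edge_cell_subset[OF that(1)] by (metis eq_iff_diff_eq_0 subsetD)
  qed
  have ex: "\<exists>n::int. \<theta> x s t = \<alpha> x t - \<alpha> x s + of_int n * (2 * pi * \<i>)"
    if "{s, t} \<in> E" "x \<notin> {s, t}" for x s t
  proof -
    have "exp (\<theta> x s t) = (F (vpoint x) - F (linepath (vpoint s) (vpoint t) 1)) / (F (vpoint x) - F (linepath (vpoint s) (vpoint t) 0))"
      unfolding \<theta>_def using contF[OF that(1)] nz[OF that]
      by (intro exp_log_change continuous_intros) auto
    also have "\<dots> = exp (\<alpha> x t - \<alpha> x s)"
      using that(2) by (simp add: exp_diff exp\<alpha> linepath_def)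
    finally obtain n :: int where "\<theta> x s t = \<alpha> x t - \<alpha> x s + (of_int (2 * n) * pi) * \<i>"
      unfolding exp_eq by blast
    then show ?thesis by (intro exI[of _ n]) (simp add: algebra_simps)
  qed
  \<comment> \<open>Edges are undirected sets; running each from its smaller to its larger end fixes
    the sign of the integer. Where \<open>x\<close> lies on \<open>e\<close> nothing is required and
    any integer qualifies.\<close>
  define P where "P x e n \<longleftrightarrow> (\<forall>s t. e = {s, t} \<and> {s, t} \<in> E \<and> x \<notin> {s, t} \<and> r s < r t \<longrightarrow>
      \<theta> x s t = \<alpha> x t - \<alpha> x s + of_int n * (2 * pi * \<i>))" for x e and n :: int
  have exP: "\<exists>n. P x e n" for x e
  proof (cases "\<exists>s t. e = {s, t} \<and> {s, t} \<in> E \<and> x \<notin> {s, t} \<and> r s < r t")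
    case True
    then obtain s t where st: "e = {s, t}" "{s, t} \<in> E" "x \<notin> {s, t}" "r s < r t" by blast
    obtain n :: int where n: "\<theta> x s t = \<alpha> x t - \<alpha> x s + of_int n * (2 * pi * \<i>)"
      using ex[OF st(2,3)] by blast
    have "s' = s \<and> t' = t" if "e = {s', t'}" "r s' < r t'" for s' t'
      using that st by (auto simp: doubleton_eq_iff)
    then have "P x e n" unfolding P_def using n by blast
    then show ?thesis by blast
  next
    case False
    then have "P x e 0" unfolding P_def by blast
    then show ?thesis by blast
  qed
  define N where "N x e = (SOME n. P x e n)" for x e
  have PN: "P x e (N x e)" for x e unfolding N_def by (rule someI_ex) (rule exP)
  have N: "\<theta> x s t = \<alpha> x t - \<alpha> x s + of_int (N x {s, t}) * (2 * pi * \<i>)"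
    if "{s, t} \<in> E" "x \<notin> {s, t}" "r s < r t" for x s t
    using PN[of x "{s, t}"] that unfolding P_def by simp
  show thesis
  proof (rule that[of N])
    fix d e assume de: "d \<in> E" "e \<in> E" "d \<inter> e = {}"
    have ends: "\<exists>a b. e = {a, b} \<and> r a < r b" if "e \<in> E" for e
    proof -
      have "card e = 2" using E that by (rule bspec)
      then obtain a b where ab: "e = {a, b}" "a \<noteq> b" unfolding card_2_iff by blast
      have "r a \<noteq> r b" using ab(2) injD[OF r] by blast
      then consider "r a < r b" | "r b < r a" by linarith
      then show ?thesis
      proof cases
        case 2
        have "e = {b, a}" unfolding ab(1) by (rule insert_commute)
        with 2 show ?thesis by blast
      qed (use ab(1) in blast)
    qed
    obtain a b where d: "d = {a, b}" and ab: "r a < r b" using ends[OF de(1)] by blast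
    obtain s t where e: "e = {s, t}" and st: "r s < r t" using ends[OF de(2)] by blast
    have dE: "{a, b} \<in> E" and eE: "{s, t} \<in> E" and disj: "{a, b} \<inter> {s, t} = {}" using de d e by auto
    have out: "s \<notin> {a, b}" "t \<notin> {a, b}" "a \<notin> {s, t}" "b \<notin> {s, t}" using disj by auto
    obtain k :: int where k: "rect_log_change
       (\<lambda>\<sigma> \<tau>. F (linepath (vpoint a) (vpoint b) \<sigma>) - F (linepath (vpoint s) (vpoint t) \<tau>)) 0 1 0 1
        = of_int k * (2 * pi * \<i>)"
      "odd k \<longleftrightarrow> odd (card (f ` edge_cell d \<inter> f ` edge_cell e))"
      using edge_crossing_parity[OF f E \<phi> dE eE disj] unfolding F_def d e by blast
    have flip: "log_change (\<lambda>\<sigma>. F (linepath (vpoint a) (vpoint b) \<sigma>) - F (vpoint x)) 0 1 = \<theta> x a b"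
      if "x \<notin> {a, b}" for x
    proof -
      have "log_change (\<lambda>\<sigma>. - (F (vpoint x) - F (linepath (vpoint a) (vpoint b) \<sigma>))) 0 1 = \<theta> x a b"
        unfolding \<theta>_def using contF[OF dE] nz[OF dE that]
        by (intro log_change_uminus continuous_intros) auto
      then show ?thesis by simp
    qed
    have lp: "linepath (vpoint x) (vpoint y) 0 = vpoint x" "linepath (vpoint x) (vpoint y) 1 = vpoint y" for x y :: 'v
      by (simp_all add: linepath_def)
    have "of_int k * (2 * pi * \<i>) = \<theta> s a b + \<theta> b s t - \<theta> t a b - \<theta> a s t"
      unfolding k(1)[symmetric] rect_log_change_def lp
      by (simp only: flip[OF out(1)] flip[OF out(2)]) (simp add: \<theta>_def)
    \<comment> \<open>Each of the four vertex pairs between \<open>d\<close> and \<open>e\<close>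
      occurs in both orders with opposite signs, so that only half-turns fixed by the order of the
      vertices survive.\<close>
    also have "\<dots> = of_int (N s d + N b e - N t d - N a e) * (2 * pi * \<i>) +
        ((\<alpha> s b - \<alpha> b s) + (\<alpha> a s - \<alpha> s a) + (\<alpha> b t - \<alpha> t b) + (\<alpha> t a - \<alpha> a t))"
      unfolding N[OF dE out(1) ab] N[OF dE out(2) ab] N[OF eE out(3) st] N[OF eE out(4) st] d e
      by (simp add: algebra_simps)
    finally have eq: "of_int k * (2 * pi * \<i>) = of_int (N s d + N b e - N t d - N a e) * (2 * pi * \<i>) +
        ((\<alpha> s b - \<alpha> b s) + (\<alpha> a s - \<alpha> s a) + (\<alpha> b t - \<alpha> t b) + (\<alpha> t a - \<alpha> a t))" .
    define sg :: "'v \<Rightarrow> 'v \<Rightarrow> int" where "sg x y = (if r x < r y then 1 else -1)" for x y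
    have \<alpha>sg: "\<alpha> y x - \<alpha> x y = of_int (sg x y) * (pi * \<i>)" if "x \<noteq> y" for x y
    proof (cases "r x < r y")
      case True
      then show ?thesis by (simp add: \<alpha> sg_def)
    next
      case False
      then have "r y < r x" using that r by (metis injD nat_neq_iff)
      then show ?thesis by (simp add: \<alpha> sg_def)
    qed
    have "of_int (2 * k) * (pi * \<i>) =
        of_int (2 * (N s d + N b e - N t d - N a e) + (sg b s + sg s a + sg t b + sg a t)) * (pi * \<i>)"
    proof -
      have "b \<noteq> s" "s \<noteq> a" "t \<noteq> b" "a \<noteq> t" using out by auto
      note this[THEN \<alpha>sg]
      then show ?thesis using eq by (simp only:) (simp add: algebra_simps)
    qed
    then have k2: "2 * k = 2 * (N s d + N b e - N t d - N a e) + (sg b s + sg s a + sg t b + sg a t)"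
      by (simp only: mult_cancel_right of_int_eq_iff) auto
    have "r a \<noteq> r s" "r a \<noteq> r t" "r b \<noteq> r s" "r b \<noteq> r t" using out r by (auto dest: injD)
    \<comment> \<open>The four signs add up to 0 for separated or nested edges and to 2 or -2 for
      interlaced ones.\<close>
    then have "\<exists>m. sg b s + sg s a + sg t b + sg a t = 2 * m \<and> (odd m \<longleftrightarrow> interlaced r {a, b} {s, t})"
      using ab st unfolding interlaced_iff[of r, OF ab st] sg_def by presburger
    then obtain m where m: "sg b s + sg s a + sg t b + sg a t = 2 * m" "odd m \<longleftrightarrow> interlaced r d e"
      unfolding d e by blast
    have "2 * k = 2 * (N s d + N b e - N t d - N a e + m)"
      using k2 unfolding m(1) distrib_left[of 2 _ m] .
    then have "k = N s d + N b e - N t d - N a e + m"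
      by (simp only: mult_cancel_left) simp
    moreover have "a \<noteq> b" "s \<noteq> t" using ab st by auto
    then have "(\<Sum>x\<in>d. N x e) = N a e + N b e" "(\<Sum>x\<in>e. N x d) = N s d + N t d"
      by (auto simp: d e)
    ultimately show "odd (card (f ` edge_cell d \<inter> f ` edge_cell e)) \<longleftrightarrow>
      odd ((\<Sum>x\<in>d. N x e) + (\<Sum>x\<in>e. N x d) + of_bool (interlaced r d e))"
      unfolding k(2)[symmetric] using m(2) by auto
  qed
qed

section \<open>Summation over pairs of edges\<close>

text \<open>Double counting: in the total correction, \<open>N x e\<close> has as coefficient the
  number of edges \<open>d\<close> at \<open>x\<close> with {d, e} in \<open>D\<close>, which is
  even. Only the interlacing pairs remain, and their number does not involve
  \<open>f\<close>.\<close>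

lemma sum_pairs_parity:
  fixes f :: "real ^ 'v::finite \<Rightarrow> real ^ 2" and r :: "'v \<Rightarrow> nat"
  assumes f: "plane_generic_immersion E f" and E: "\<forall>e\<in>E. card e = 2" and r: "inj r"
    and disj: "\<And>d e. {d, e} \<in> D \<Longrightarrow> d \<in> E \<and> e \<in> E \<and> d \<inter> e = {}"
    and pairs: "\<And>P. P \<in> D \<Longrightarrow> \<exists>d e. P = {d, e}"
    and even: "\<And>e x. e \<in> E \<Longrightarrow> even (card {d \<in> E. x \<in> d \<and> {d, e} \<in> D})"
  shows "odd (\<Sum>P\<in>D. card (\<Inter>d\<in>P. f ` edge_cell d)) \<longleftrightarrow>
    odd (card {P \<in> D. \<exists>d e. P = {d, e} \<and> interlaced r d e})"
proof -
  obtain N :: "'v \<Rightarrow> 'v set \<Rightarrow> int" where N: "\<And>d e. d \<in> E \<Longrightarrow> e \<in> E \<Longrightarrow> d \<inter> e = {} \<Longrightarrow>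
      odd (card (f ` edge_cell d \<inter> f ` edge_cell e)) \<longleftrightarrow>
      odd ((\<Sum>x\<in>d. N x e) + (\<Sum>x\<in>e. N x d) + of_bool (interlaced r d e))"
    using vertex_edge_parity[OF f E r] by blast
  define M where "M z = (\<Sum>x\<in>fst z. N x (snd z))" for z
  \<comment> \<open>Ordered pairs: \<open>M (d, e)\<close> collects the \<open>N x e\<close> with
    \<open>x\<close> in \<open>d\<close>, so the two orders of an unordered pair together give its
    whole correction.\<close>
  define T where "T = {(d, e). {d, e} \<in> D}"
  define I where "I P \<longleftrightarrow> (\<exists>d e. P = {d, e} \<and> interlaced r d e)" for P
  have sym: "interlaced r d e \<longleftrightarrow> interlaced r e d" for d e
    unfolding interlaced_def by blast
  have I: "I {d, e} \<longleftrightarrow> interlaced r d e" for d e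
    unfolding I_def using sym by (auto simp: doubleton_eq_iff)
  have "D = (\<lambda>(d, e). {d, e}) ` T"
    using pairs unfolding T_def by (auto simp: image_iff)
  moreover have "finite T" by simp
  ultimately have "sum M T = (\<Sum>P\<in>D. sum M {z \<in> T. (case z of (d, e) \<Rightarrow> {d, e}) = P})"
    using sum.image_gen[of T M "\<lambda>(d, e). {d, e}"] by simp
  have local: "even (int (card (\<Inter>d\<in>P. f ` edge_cell d)) -
      (sum M {z \<in> T. (case z of (d, e) \<Rightarrow> {d, e}) = P} + of_bool (I P)))" if "P \<in> D" for P
  proof -
    have "\<exists>d e. P = {d, e}" using pairs[OF that] .
    then obtain d e where P: "P = {d, e}" by blast
    have de: "d \<in> E" "e \<in> E" "d \<inter> e = {}" using disj[of d e] \<open>P \<in> D\<close> P by auto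
    then have "d \<noteq> e" using E by auto
    have "{z \<in> T. (case z of (d, e) \<Rightarrow> {d, e}) = P} = {(d, e), (e, d)}"
      using that by (auto simp: T_def P doubleton_eq_iff insert_commute)
    then have "sum M {z \<in> T. (case z of (d, e) \<Rightarrow> {d, e}) = P} = (\<Sum>x\<in>d. N x e) + (\<Sum>x\<in>e. N x d)"
      using \<open>d \<noteq> e\<close> by (simp add: M_def)
    moreover have "(\<Inter>d\<in>P. f ` edge_cell d) = f ` edge_cell d \<inter> f ` edge_cell e" by (simp add: P)
    ultimately show ?thesis using N[OF de] unfolding P I by auto
  qed
  have "sum M T = (\<Sum>(e, d)\<in>(SIGMA e:E. {d \<in> E. {d, e} \<in> D}). M (d, e))"
    by (rule sum.reindex_bij_witness[of _ "\<lambda>(e, d). (d, e)" "\<lambda>(d, e). (e, d)"])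
       (use disj in \<open>auto simp: T_def\<close>)
  also have "\<dots> = (\<Sum>e\<in>E. \<Sum>d\<in>{d \<in> E. {d, e} \<in> D}. \<Sum>x\<in>d. N x e)"
    by (simp add: sum.Sigma[symmetric] M_def)
  also have "\<dots> = (\<Sum>e\<in>E. \<Sum>x\<in>UNIV. of_nat (card {d \<in> E. x \<in> d \<and> {d, e} \<in> D}) * N x e)"
  proof (rule sum.cong)
    fix e
    \<comment> \<open>The inner sum is extended by zeros to all vertices, so that its range no
      longer depends on \<open>d\<close> and the sums can be exchanged.\<close>
    have "(\<Sum>d\<in>{d \<in> E. {d, e} \<in> D}. \<Sum>x\<in>d. N x e) =
        (\<Sum>d\<in>{d \<in> E. {d, e} \<in> D}. \<Sum>x\<in>UNIV. if x \<in> d then N x e else 0)"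
      using sum.inter_restrict[of UNIV "\<lambda>x. N x e"] by simp
    also have "\<dots> = (\<Sum>x\<in>UNIV. \<Sum>d\<in>{d \<in> E. {d, e} \<in> D}. if x \<in> d then N x e else 0)"
      by (rule sum.swap)
    also have "\<dots> = (\<Sum>x\<in>UNIV. of_nat (card {d \<in> E. x \<in> d \<and> {d, e} \<in> D}) * N x e)"
    proof (rule sum.cong)
      fix x
      have "{d \<in> {d \<in> E. {d, e} \<in> D}. x \<in> d} = {d \<in> E. x \<in> d \<and> {d, e} \<in> D}" by blast
      then show "(\<Sum>d\<in>{d \<in> E. {d, e} \<in> D}. if x \<in> d then N x e else 0) =
          of_nat (card {d \<in> E. x \<in> d \<and> {d, e} \<in> D}) * N x e"
        by (simp add: sum.inter_filter[symmetric])
    qed simp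
    finally show "(\<Sum>d\<in>{d \<in> E. {d, e} \<in> D}. \<Sum>x\<in>d. N x e) =
        (\<Sum>x\<in>UNIV. of_nat (card {d \<in> E. x \<in> d \<and> {d, e} \<in> D}) * N x e)" .
  qed simp
  finally have "even (sum M T)"
    using even by (auto intro!: dvd_sum)
  moreover have "even (\<Sum>P\<in>D. int (card (\<Inter>d\<in>P. f ` edge_cell d)) -
      (sum M {z \<in> T. (case z of (d, e) \<Rightarrow> {d, e}) = P} + of_bool (I P)))"
    using local by (intro dvd_sum)
  moreover have "(\<Sum>P\<in>D. of_bool (I P)) = int (card {P \<in> D. I P})"
    by (simp add: of_bool_def sum.inter_filter[symmetric])
  ultimately have "even (int (\<Sum>P\<in>D. card (\<Inter>d\<in>P. f ` edge_cell d)) - int (card {P \<in> D. I P}))"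
    using \<open>sum M T = (\<Sum>P\<in>D. _ P)\<close> by (simp add: sum_subtractf sum.distrib)
  then show ?thesis unfolding I_def by (simp del: of_nat_sum)
qed

section \<open>Pairs of edges at distance two\<close>

lemma graph_path_short:
  "graph_path E [x] \<longleftrightarrow> True"
  "graph_path E [x, y] \<longleftrightarrow> x \<noteq> y \<and> {x, y} \<in> E"
  "graph_path E [x, z, y] \<longleftrightarrow> distinct [x, z, y] \<and> {x, z} \<in> E \<and> {z, y} \<in> E"
  by (auto simp: graph_path_def less_Suc_eq)

text \<open>The infimum is attained, so the value 2 means a path on three vertices and none on
  fewer; a one-vertex path is a common vertex and a two-vertex path is a joining edge.\<close>

lemma subgraph_dist_eq_2_iff:
  assumes E: "\<forall>e\<in>E. card e = 2"
  shows "subgraph_dist E A B = 2 \<longleftrightarrow>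
    A \<inter> B = {} \<and> (\<forall>x\<in>A. \<forall>y\<in>B. {x, y} \<notin> E) \<and> (\<exists>x\<in>A. \<exists>y\<in>B. \<exists>z. {x, z} \<in> E \<and> {z, y} \<in> E)"
    (is "_ \<longleftrightarrow> ?far")
proof -
  define S where "S = {enat (length xs - 1) | xs. graph_path E xs \<and> hd xs \<in> A \<and> last xs \<in> B}"
  have neq: "x \<noteq> y" if "{x, y} \<in> E" for x y using E that by (auto dest: bspec)
  have dist: "subgraph_dist E A B = Inf S" by (simp add: subgraph_dist_def S_def)
  show ?thesis
  proof
    assume d: "subgraph_dist E A B = 2"
    then have "S \<noteq> {}" unfolding dist by (auto simp: top_enat_def)
    then have "Inf S \<in> S" by (metis ex_in_conv wellorder_InfI)
    then obtain xs where xs: "graph_path E xs" "hd xs \<in> A" "last xs \<in> B" "length xs - 1 = 2"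
      using d unfolding dist S_def by (auto simp: numeral_eq_enat)
    have low: "2 \<le> length xs - 1" if "graph_path E xs" "hd xs \<in> A" "last xs \<in> B" for xs
    proof -
      have "Inf S \<le> enat (length xs - 1)" by (rule Inf_lower) (use that in \<open>auto simp: S_def\<close>)
      then show ?thesis using d unfolding dist by (simp add: numeral_eq_enat)
    qed
    have "length xs = Suc (Suc (Suc 0))" using xs(4) by simp
    then obtain x z y where "xs = [x, z, y]" by (auto simp: length_Suc_conv)
    with xs have "\<exists>x\<in>A. \<exists>y\<in>B. \<exists>z. {x, z} \<in> E \<and> {z, y} \<in> E" by (auto simp: graph_path_short)
    moreover have "A \<inter> B = {}" using low[of "[_]"] by (auto simp: graph_path_short)
    moreover have "{x, y} \<notin> E" if "x \<in> A" "y \<in> B" for x y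
      using low[of "[x, y]"] that neq[of x y] by (auto simp: graph_path_short)
    ultimately show ?far by blast
  next
    assume far: ?far
    then obtain x y z where xyz: "x \<in> A" "y \<in> B" "{x, z} \<in> E" "{z, y} \<in> E" by blast
    then have "graph_path E [x, z, y]" using far neq[of x z] neq[of z y] by (auto simp: graph_path_short)
    then have "enat (length [x, z, y] - 1) \<in> S"
      unfolding S_def using xyz by (intro CollectI exI[of _ "[x, z, y]"]) auto
    then have "2 \<in> S" by (simp add: numeral_eq_enat numeral_2_eq_2)
    moreover have "2 \<le> n" if "n \<in> S" for n
    proof -
      obtain xs where xs: "n = enat (length xs - 1)" "graph_path E xs" "hd xs \<in> A" "last xs \<in> B"
        using \<open>n \<in> S\<close> unfolding S_def by blast
      have "length xs \<noteq> 0" using xs by (auto simp: graph_path_def)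
      moreover have "length xs \<noteq> Suc 0" using xs far by (auto simp: length_Suc_conv)
      moreover have "length xs \<noteq> Suc (Suc 0)" using xs far by (auto simp: length_Suc_conv graph_path_short)
      ultimately have "2 \<le> length xs - 1" by linarith
      then show ?thesis using xs(1) by (simp add: numeral_eq_enat)
    qed
    ultimately have "Inf S = 2" by (intro antisym Inf_lower Inf_greatest)
    then show "subgraph_dist E A B = 2" by (simp add: dist)
  qed
qed

section \<open>The Heawood graph\<close>

lemma UNIV_7: "(UNIV :: 7 set) = {0, 1, 2, 3, 4, 5, 6}"
proof -
  have "card {0, 1, 2, 3, 4, 5, 6 :: 7} = CARD(7)" by simp
  then have "{0, 1, 2, 3, 4, 5, 6 :: 7} = UNIV" by (intro card_subset_eq) auto
  then show ?thesis by simp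
qed

text \<open>Numbering the vertices turns the finite checks into computations on lists of natural
  numbers; the same numbering later serves as the linear order.\<close>

definition heawood_vertices :: "heawood_vertex list" where
  "heawood_vertices = [HU 0, HU 1, HU 2, HU 3, HU 4, HU 5, HU 6, HV 0, HV 1, HV 2, HV 3, HV 4, HV 5, HV 6]"

lemma distinct_heawood_vertices: "distinct heawood_vertices"
  by (simp add: heawood_vertices_def)

lemma set_heawood_vertices: "set heawood_vertices = UNIV"
proof -
  have "x \<in> set heawood_vertices" for x
  proof (cases x)
    case (HU i)
    have "i \<in> {0, 1, 2, 3, 4, 5, 6}" using UNIV_7 by blast
    then show ?thesis by (auto simp: HU heawood_vertices_def)
  next
    case (HV i)
    have "i \<in> {0, 1, 2, 3, 4, 5, 6}" using UNIV_7 by blast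
    then show ?thesis by (auto simp: HV heawood_vertices_def)
  qed
  then show ?thesis by blast
qed

text \<open>Three blocks of seven, for i = 0, ..., 6: the edges u_i v_i, u_i v_{i-1} and u_{i-2}
  v_i, always with the u-end first.\<close>

definition heawood_pairs :: "(nat \<times> nat) list" where
  "heawood_pairs = [(0,7), (1,8), (2,9), (3,10), (4,11), (5,12), (6,13), (0,13), (1,7), (2,8), (3,9), (4,10), (5,11), (6,12), (5,7), (6,8), (0,9), (1,10), (2,11), (3,12), (4,13)]"

fun numbered_edge :: "nat \<times> nat \<Rightarrow> heawood_vertex set" where
  "numbered_edge (i, j) = {heawood_vertices ! i, heawood_vertices ! j}"

lemma heawood_eq: "heawood = numbered_edge ` set heawood_pairs"
proof -
  have [simp]: "(- 1 :: 7) = 6" "(- 2 :: 7) = 5"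
    by (simp_all add: neg_eq_iff_add_eq_0)
  have "range (\<lambda>i. {HU i, HV i}) = numbered_edge ` set (take 7 heawood_pairs)"
    "range (\<lambda>i. {HU i, HV (i - 1)}) = numbered_edge ` set (take 7 (drop 7 heawood_pairs))"
    "range (\<lambda>i. {HV i, HU (i - 2)}) = numbered_edge ` set (drop 14 heawood_pairs)"
    by (simp_all add: UNIV_7 heawood_pairs_def heawood_vertices_def insert_commute[of "HU _" "HV _"])
  moreover have "heawood_pairs = (take 7 heawood_pairs @ take 7 (drop 7 heawood_pairs)) @ drop 14 heawood_pairs"
    by (simp add: heawood_pairs_def)
  then have "set heawood_pairs = set (take 7 heawood_pairs) \<union> set (take 7 (drop 7 heawood_pairs)) \<union> set (drop 14 heawood_pairs)"
    by (metis set_append)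
  ultimately show ?thesis unfolding heawood_def by (simp only: image_Un)
qed

lemma distinct_heawood_pairs: "distinct heawood_pairs"
  by (simp add: heawood_pairs_def)

lemma heawood_pairs_bounds: "(i, j) \<in> set heawood_pairs \<Longrightarrow> i < 7 \<and> 7 \<le> j \<and> j < 14"
  by (auto simp: heawood_pairs_def)

lemma numbered_vertices_eq_iff:
  "i < 14 \<Longrightarrow> j < 14 \<Longrightarrow> heawood_vertices ! i = heawood_vertices ! j \<longleftrightarrow> i = j"
  using nth_eq_iff_index_eq[OF distinct_heawood_vertices] by (simp add: heawood_vertices_def)

lemma numbered_edge_eq_iff:
  assumes "i < 14" "j < 14" "k < 14" "l < 14"
  shows "numbered_edge (i, j) = numbered_edge (k, l) \<longleftrightarrow> i = k \<and> j = l \<or> i = l \<and> j = k"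
  using assms by (simp add: doubleton_eq_iff numbered_vertices_eq_iff)

lemma inj_on_numbered_edge: "inj_on numbered_edge (set heawood_pairs)"
proof (rule inj_onI)
  fix z w assume "z \<in> set heawood_pairs" "w \<in> set heawood_pairs" "numbered_edge z = numbered_edge w"
  then show "z = w"
    using heawood_pairs_bounds[of "fst z" "snd z"] heawood_pairs_bounds[of "fst w" "snd w"]
      numbered_edge_eq_iff[of "fst z" "snd z" "fst w" "snd w"] by (auto simp: prod_eq_iff)
qed

lemma numbered_edge_in_heawood_iff:
  assumes "i < 14" "j < 14"
  shows "{heawood_vertices ! i, heawood_vertices ! j} \<in> heawood \<longleftrightarrow>
    (i, j) \<in> set heawood_pairs \<or> (j, i) \<in> set heawood_pairs"
proof
  assume "{heawood_vertices ! i, heawood_vertices ! j} \<in> heawood"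
  then obtain k l where kl: "(k, l) \<in> set heawood_pairs" "numbered_edge (i, j) = numbered_edge (k, l)"
    unfolding heawood_eq by auto
  then show "(i, j) \<in> set heawood_pairs \<or> (j, i) \<in> set heawood_pairs"
    using heawood_pairs_bounds[OF kl(1)] assms numbered_edge_eq_iff[of i j k l] by auto
next
  assume "(i, j) \<in> set heawood_pairs \<or> (j, i) \<in> set heawood_pairs"
  then have "numbered_edge (i, j) \<in> heawood \<or> numbered_edge (j, i) \<in> heawood"
    unfolding heawood_eq by blast
  then show "{heawood_vertices ! i, heawood_vertices ! j} \<in> heawood"
    by (auto simp: insert_commute)
qed

lemma card_heawood_edge: "\<forall>e\<in>heawood. card e = 2"
proof
  fix e assume "e \<in> heawood"
  then obtain i j where ij: "(i, j) \<in> set heawood_pairs" "e = numbered_edge (i, j)"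
    unfolding heawood_eq by auto
  then show "card e = 2"
    using heawood_pairs_bounds[OF ij(1)] numbered_vertices_eq_iff[of i j] by auto
qed

text \<open>In a bipartite graph only the two mixed pairs of ends can coincide with edges, so these
  four conditions say that the edges are disjoint and no edge joins them.\<close>

fun far :: "nat \<times> nat \<Rightarrow> nat \<times> nat \<Rightarrow> bool" where
  "far (a, b) (c, d) \<longleftrightarrow> a \<noteq> c \<and> b \<noteq> d \<and> (a, d) \<notin> set heawood_pairs \<and> (c, b) \<notin> set heawood_pairs"

text \<open>Two points of the Fano plane lie on a line: u_i is adjacent to v_{i-1}, v_i and v_{i+2},
  and {-1, 0, 2} is a difference set modulo 7.\<close>

lemma heawood_common_neighbour:
  "\<forall>z\<in>set heawood_pairs. \<forall>w\<in>set heawood_pairs. \<exists>v\<in>snd ` set heawood_pairs.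
     (fst z, v) \<in> set heawood_pairs \<and> (fst w, v) \<in> set heawood_pairs"
  by code_simp

text \<open>A common neighbour of the two u-ends gives a path of length 2, so no pair of edges is at
  a distance above 2 and excluding shorter paths is enough.\<close>

lemma numbered_edges_dist_2_iff:
  assumes z: "z \<in> set heawood_pairs" and w: "w \<in> set heawood_pairs"
  shows "subgraph_dist heawood (numbered_edge z) (numbered_edge w) = 2 \<longleftrightarrow> far z w"
proof -
  obtain a b c d where zw: "z = (a, b)" "w = (c, d)" by fastforce
  have bounds: "a < 7" "7 \<le> b" "b < 14" "c < 7" "7 \<le> d" "d < 14"
    using z w heawood_pairs_bounds unfolding zw by auto
  have no: "(b, d) \<notin> set heawood_pairs" "(d, b) \<notin> set heawood_pairs" "(b, c) \<notin> set heawood_pairs"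
      "(d, a) \<notin> set heawood_pairs" "(a, c) \<notin> set heawood_pairs" "(c, a) \<notin> set heawood_pairs"
    using bounds heawood_pairs_bounds by (meson leD)+
  obtain v where v: "(a, v) \<in> set heawood_pairs" "(c, v) \<in> set heawood_pairs"
    using heawood_common_neighbour z w unfolding zw by fastforce
  have "{heawood_vertices ! a, heawood_vertices ! v} \<in> heawood" "{heawood_vertices ! v, heawood_vertices ! c} \<in> heawood"
    using v heawood_pairs_bounds[OF v(1)] bounds by (auto simp: numbered_edge_in_heawood_iff)
  then have "\<exists>x\<in>numbered_edge z. \<exists>y\<in>numbered_edge w. \<exists>z. {x, z} \<in> heawood \<and> {z, y} \<in> heawood"
    unfolding zw by auto
  then show ?thesis
    unfolding subgraph_dist_eq_2_iff[OF card_heawood_edge] zw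
    using bounds no by (auto simp: numbered_edge_in_heawood_iff numbered_vertices_eq_iff)
qed

lemma far_sym: "far z w \<longleftrightarrow> far w z"
  by (cases z; cases w) auto

lemma mem_edge_pairs_at_dist_iff:
  "P \<in> edge_pairs_at_dist k E \<longleftrightarrow> (\<exists>d\<in>E. \<exists>e\<in>E. d \<noteq> e \<and> subgraph_dist E d e = k \<and> P = {d, e})"
  unfolding edge_pairs_at_dist_def mem_Collect_eq by (intro iffI; elim exE bexE conjE; intro exI bexI conjI; assumption)

lemma far_pairs_iff:
  assumes z: "z \<in> set heawood_pairs" and w: "w \<in> set heawood_pairs"
  shows "{numbered_edge z, numbered_edge w} \<in> edge_pairs_at_dist 2 heawood \<longleftrightarrow> far z w"
proof
  assume "{numbered_edge z, numbered_edge w} \<in> edge_pairs_at_dist 2 heawood"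
  then obtain d e where *: "{numbered_edge z, numbered_edge w} = {d, e}" "subgraph_dist heawood d e = 2"
    unfolding mem_edge_pairs_at_dist_iff by (elim bexE conjE)
  then consider "d = numbered_edge z" "e = numbered_edge w" | "d = numbered_edge w" "e = numbered_edge z"
    by (auto simp: doubleton_eq_iff)
  then show "far z w"
    by cases (use * assms numbered_edges_dist_2_iff far_sym in auto)
next
  assume "far z w"
  then have "z \<noteq> w" by (cases z) auto
  then have "numbered_edge z \<noteq> numbered_edge w" using inj_on_numbered_edge z w by (auto dest: inj_onD)
  then show "{numbered_edge z, numbered_edge w} \<in> edge_pairs_at_dist 2 heawood"
    unfolding mem_edge_pairs_at_dist_iff heawood_eq
    using \<open>far z w\<close> numbered_edges_dist_2_iff[OF z w, unfolded heawood_eq]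
    by (intro bexI[of _ "numbered_edge z"] bexI[of _ "numbered_edge w"] conjI imageI z w) auto
qed

lemma far_pairsE:
  assumes "P \<in> edge_pairs_at_dist 2 heawood"
  obtains z w where "z \<in> set heawood_pairs" "w \<in> set heawood_pairs" "far z w" "P = {numbered_edge z, numbered_edge w}"
proof -
  from assms obtain d e where de: "d \<in> heawood" "e \<in> heawood" "subgraph_dist heawood d e = 2" "P = {d, e}"
    unfolding mem_edge_pairs_at_dist_iff by (elim bexE conjE)
  obtain z w where zw: "z \<in> set heawood_pairs" "w \<in> set heawood_pairs" "d = numbered_edge z" "e = numbered_edge w"
    using de(1,2) unfolding heawood_eq by (elim imageE)
  have "far z w" using de(3) numbered_edges_dist_2_iff[OF zw(1,2)] unfolding zw(3,4) by blast
  then show thesis using that zw de(4) by simp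
qed

text \<open>Let w = (c, d). A u-vertex other than \<open>c\<close> and not adjacent to
  \<open>d\<close> has exactly one neighbour in common with \<open>c\<close>, and its other two
  neighbours give its far edges; other u-vertices have none. The same holds for v-vertices by
  duality, so each count is 0 or 2.\<close>

lemma even_far_edges_at_vertex:
  "\<forall>w\<in>set heawood_pairs. \<forall>i\<in>set [0..<14]. even (length (filter (\<lambda>z. (i = fst z \<or> i = snd z) \<and> far z w) heawood_pairs))"
  by code_simp

text \<open>With all u before all v, two edges interlace exactly if their u-ends and their v-ends
  are ordered alike. The strict order of the u-ends lists each unordered pair once.\<close>

lemma odd_interlaced_far_pairs:
  "odd (length (filter (\<lambda>(z, w). fst z < fst w \<and> snd z < snd w \<and> far z w) (List.product heawood_pairs heawood_pairs)))"
  by code_simp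

lemma odd_sum_far_crossings:
  fixes f :: "real ^ heawood_vertex \<Rightarrow> real ^ 2"
  assumes f: "plane_generic_immersion heawood f"
  shows "odd (\<Sum>P\<in>edge_pairs_at_dist 2 heawood. card (\<Inter>d\<in>P. f ` edge_cell d))"
proof -
  define r where "r = the_inv_into {..<14} (\<lambda>i. heawood_vertices ! i)"
  have len: "length heawood_vertices = 14" by (simp add: heawood_vertices_def)
  have inj: "inj_on (\<lambda>i. heawood_vertices ! i) {..<14}"
    by (auto simp: inj_on_def numbered_vertices_eq_iff)
  have surj: "\<exists>i<14. heawood_vertices ! i = x" for x
    using set_heawood_vertices in_set_conv_nth[of x heawood_vertices] len by auto
  have r: "r (heawood_vertices ! i) = i" if "i < 14" for i
    unfolding r_def using the_inv_into_f_f[OF inj] that by simp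
  have "inj r"
  proof (rule injI)
    fix x y assume "r x = r y"
    with surj[of x] surj[of y] show "x = y" by (auto simp: r)
  qed
  have disj: "d \<in> heawood \<and> e \<in> heawood \<and> d \<inter> e = {}" if de: "{d, e} \<in> edge_pairs_at_dist 2 heawood" for d e
  proof -
    obtain z w where zw: "z \<in> set heawood_pairs" "w \<in> set heawood_pairs" "far z w" "{d, e} = {numbered_edge z, numbered_edge w}"
      using far_pairsE[OF de] .
    have "numbered_edge z \<inter> numbered_edge w = {}"
      using numbered_edges_dist_2_iff[OF zw(1,2)] zw(3)
      unfolding subgraph_dist_eq_2_iff[OF card_heawood_edge] by blast
    moreover have "numbered_edge z \<in> heawood" "numbered_edge w \<in> heawood"
      unfolding heawood_eq using zw(1,2) by simp_all
    ultimately show ?thesis using zw(4) unfolding doubleton_eq_iff by (elim disjE conjE) (simp_all add: Int_commute)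
  qed
  have pairs: "\<exists>d e. P = {d, e}" if "P \<in> edge_pairs_at_dist 2 heawood" for P
    using far_pairsE[OF that] by metis
  have even: "even (card {d \<in> heawood. x \<in> d \<and> {d, e} \<in> edge_pairs_at_dist 2 heawood})" if "e \<in> heawood" for e x
  proof -
    obtain w where w: "w \<in> set heawood_pairs" "e = numbered_edge w" using \<open>e \<in> heawood\<close> unfolding heawood_eq by (elim imageE)
    obtain i where i: "i < 14" "x = heawood_vertices ! i" using surj[of x] by metis
    let ?F = "filter (\<lambda>z. (i = fst z \<or> i = snd z) \<and> far z w) heawood_pairs"
    have mem: "x \<in> numbered_edge z \<longleftrightarrow> i = fst z \<or> i = snd z" if "z \<in> set heawood_pairs" for z
      using heawood_pairs_bounds[of "fst z" "snd z"] that i by (cases z) (auto simp: numbered_vertices_eq_iff)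
    have "{d \<in> heawood. x \<in> d \<and> {d, e} \<in> edge_pairs_at_dist 2 heawood} = {d \<in> numbered_edge ` set heawood_pairs. x \<in> d \<and> {d, e} \<in> edge_pairs_at_dist 2 heawood}"
      by (simp only: heawood_eq[symmetric])
    also have "\<dots> = numbered_edge ` {z \<in> set heawood_pairs. x \<in> numbered_edge z \<and> {numbered_edge z, e} \<in> edge_pairs_at_dist 2 heawood}"
      by (rule Compr_image_eq)
    also have "{z \<in> set heawood_pairs. x \<in> numbered_edge z \<and> {numbered_edge z, e} \<in> edge_pairs_at_dist 2 heawood} = set ?F"
      unfolding set_filter w(2) by (rule Collect_cong) (use mem far_pairs_iff[OF _ w(1)] in metis)
    finally have "{d \<in> heawood. x \<in> d \<and> {d, e} \<in> edge_pairs_at_dist 2 heawood} = numbered_edge ` set ?F" .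
    moreover have "card (numbered_edge ` set ?F) = card (set ?F)"
      by (rule card_image[OF inj_on_subset[OF inj_on_numbered_edge]]) auto
    moreover have "card (set ?F) = length ?F"
      by (intro distinct_card distinct_filter distinct_heawood_pairs)
    moreover have "i \<in> set [0..<14]" using i(1) by simp
    then have "even (length ?F)" using even_far_edges_at_vertex w(1) by blast
    ultimately show ?thesis by (simp only:)
  qed
  let ?L = "filter (\<lambda>(z, w). fst z < fst w \<and> snd z < snd w \<and> far z w) (List.product heawood_pairs heawood_pairs)"
  let ?e2 = "\<lambda>(z, w). {numbered_edge z, numbered_edge w}"
  have il: "interlaced r (numbered_edge z) (numbered_edge w) \<longleftrightarrow>
      fst z < fst w \<and> snd z < snd w \<or> fst w < fst z \<and> snd w < snd z"
    if "z \<in> set heawood_pairs" "w \<in> set heawood_pairs" for z w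
  proof -
    obtain a b c d where zw: "z = (a, b)" "w = (c, d)" by fastforce
    have bounds: "a < 7" "7 \<le> b" "b < 14" "c < 7" "7 \<le> d" "d < 14"
      using that heawood_pairs_bounds unfolding zw by auto
    have "r (heawood_vertices ! a) < r (heawood_vertices ! b)" "r (heawood_vertices ! c) < r (heawood_vertices ! d)"
      using bounds by (simp_all add: r)
    from interlaced_iff[of r, OF this] show ?thesis
      using bounds by (simp add: zw r)
  qed
  have sym: "interlaced r d e \<longleftrightarrow> interlaced r e d" for d e
    unfolding interlaced_def by blast
  have "{P \<in> edge_pairs_at_dist 2 heawood. \<exists>d e. P = {d, e} \<and> interlaced r d e} = ?e2 ` set ?L"
  proof (intro equalityI subsetI)
    fix P assume "P \<in> {P \<in> edge_pairs_at_dist 2 heawood. \<exists>d e. P = {d, e} \<and> interlaced r d e}"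
    then obtain d e where P: "P \<in> edge_pairs_at_dist 2 heawood" "P = {d, e}" "interlaced r d e" by auto
    obtain z w where zw: "z \<in> set heawood_pairs" "w \<in> set heawood_pairs" "far z w" "P = {numbered_edge z, numbered_edge w}"
      using far_pairsE[OF P(1)] .
    have "interlaced r (numbered_edge z) (numbered_edge w)"
      using P(2,3) zw(4) sym by (auto simp: doubleton_eq_iff)
    then consider "fst z < fst w" "snd z < snd w" | "fst w < fst z" "snd w < snd z"
      using il[OF zw(1,2)] by blast
    then show "P \<in> ?e2 ` set ?L"
    proof cases
      case 1
      then have "(z, w) \<in> set ?L" using zw by simp
      then show ?thesis by (rule rev_image_eqI) (simp add: zw(4))
    next
      case 2
      then have "(w, z) \<in> set ?L" using zw far_sym[of z w] by simp
      then show ?thesis by (rule rev_image_eqI) (simp add: zw(4) insert_commute)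
    qed
  next
    fix P assume "P \<in> ?e2 ` set ?L"
    then obtain z w where zw: "z \<in> set heawood_pairs" "w \<in> set heawood_pairs" "far z w"
      "fst z < fst w" "snd z < snd w" "P = {numbered_edge z, numbered_edge w}" by auto
    then show "P \<in> {P \<in> edge_pairs_at_dist 2 heawood. \<exists>d e. P = {d, e} \<and> interlaced r d e}"
      using il[OF zw(1,2)] far_pairs_iff[OF zw(1,2)] by auto
  qed
  \<comment> \<open>Exchanging the two edges would reverse the strict order of their u-ends, so no
    unordered pair is listed twice.\<close>
  moreover have "card (?e2 ` set ?L) = card (set ?L)"
  proof (rule card_image, rule inj_onI)
    fix p p' assume p: "p \<in> set ?L" "p' \<in> set ?L" "?e2 p = ?e2 p'"
    obtain a b c d a' b' c' d' where pp: "p = ((a, b), (c, d))" "p' = ((a', b'), (c', d'))" by (metis surj_pair)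
    from p have eq: "{numbered_edge (a, b), numbered_edge (c, d)} = {numbered_edge (a', b'), numbered_edge (c', d')}"
      unfolding pp by (simp only: case_prod_conv)
    from p have mem: "(a, b) \<in> set heawood_pairs" "(c, d) \<in> set heawood_pairs"
        "(a', b') \<in> set heawood_pairs" "(c', d') \<in> set heawood_pairs" "a < c" "a' < c'" unfolding pp by auto
    note inj = inj_onD[OF inj_on_numbered_edge]
    from eq show "p = p'"
      unfolding doubleton_eq_iff
    proof (elim disjE conjE)
      assume "numbered_edge (a, b) = numbered_edge (a', b')" "numbered_edge (c, d) = numbered_edge (c', d')"
      then show ?thesis using inj[OF _ mem(1,3)] inj[OF _ mem(2,4)] by (simp add: pp)
    next
      assume "numbered_edge (a, b) = numbered_edge (c', d')" "numbered_edge (c, d) = numbered_edge (a', b')"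
      then show ?thesis using inj[OF _ mem(1,4)] inj[OF _ mem(2,3)] mem(5,6) by (simp add: pp)
    qed
  qed
  moreover have "card (set ?L) = length ?L"
    by (intro distinct_card distinct_filter distinct_product distinct_heawood_pairs)
  ultimately have "odd (card {P \<in> edge_pairs_at_dist 2 heawood. \<exists>d e. P = {d, e} \<and> interlaced r d e})"
    using odd_interlaced_far_pairs by (simp only: not_False_eq_True)
  then show ?thesis
    using sum_pairs_parity[OF f card_heawood_edge \<open>inj r\<close> disj pairs even] by blast
qed

theorem theorem1p7:
  fixes f :: "real ^ heawood_vertex \<Rightarrow> real ^ 2"
  assumes "plane_generic_immersion heawood f"
  shows "[(\<Sum>P\<in>edge_pairs_at_dist 2 heawood. card (\<Inter>d\<in>P. f ` edge_cell d)) = 1] (mod 2)"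
  using odd_sum_far_crossings[OF assms] by (simp add: cong_def odd_iff_mod_2_eq_one)

end
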